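(* Let $T$ be a tree of order $n \ge 3$ with maximum degree $\Delta$. Then \[ F_t(T) \le \frac{(\Delta - 1)n + 1}{\Delta}, \] with equality if and only if $T \in \mathcal{T}_{\Delta}$.
   Context: All graphs are finite, simple and undirected. Forcing process: given a graph $G$ and an initial set $S \subseteq V(G)$ of colored vertices, at each step a colored vertex that has exactly one non-colored neighbor forces (colors) that neighbor. $S$ is a forcing set if iterating this eventually colors all of $V(G)$. A total forcing set (TF-set) is a forcing set $S$ such that $G[S]$ has no isolated vertex; $F_t(G)$ is the minimum cardinality of a TF-set of $G$. A leaf is a vertex of degree $1$; a strong support vertex is a vertex adjacent to at least two leaves. The family $\mathcal{T}_{\Delta}$ consists of all trees $T$ with maximum degree $\Delta$ whose vertex set can be partitioned into sets $V_1,\ldots,V_k$ ($k\ge 1$) such that, with $T_i = T[V_i]$: (i) $T_1 \cong K_{1,\Delta}$, and if $k \ge 2$ then $T_i \cong K_{1,\Delta-1}$ for all $i \in \{2,\ldots,k\}$; (ii) for each $i$, the central vertex $v_i$ of the star $T_i$ (its non-leaf vertex) is a strong support vertex of degree $\Delta$ in $T$; (iii) $\{v_1,\ldots,v_k\}$ is an independent set in $T$. *)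

theory Defs
  imports
    Complex_Main
    "HOL-Library.Disjoint_Sets"
    "Graph_Theory.Graph_Theory"
begin

text \<open>
  A finite simple undirected graph is an instance of the locale \<^locale>\<open>graph\<close>: a finite
  symmetric digraph without loops or parallel arcs. Each undirected edge is a pair of opposite
  arcs, so the degree of a vertex is its \<^const>\<open>out_degree\<close>.
\<close>

text \<open>
  Every edge \<open>uv\<close> yields a directed cycle \<open>u, v, u\<close> of length 2, so the library's
  \<^const>\<open>forest\<close> and \<^const>\<open>tree\<close> exclude all edges of a symmetric digraph.
  Cycles of an undirected graph are those of length at least 3.
\<close>

definition undirected_tree :: "('a, 'b) pre_digraph \<Rightarrow> bool" where
  "undirected_tree G \<longleftrightarrow>
     graph G \<and> connected G \<and> \<not> (\<exists>p. pre_digraph.cycle G p \<and> length p \<ge> 3)"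

definition max_degree :: "('a, 'b) pre_digraph \<Rightarrow> nat" where
  "max_degree G = Max (out_degree G ` verts G)"

definition leaf :: "('a, 'b) pre_digraph \<Rightarrow> 'a \<Rightarrow> bool" where
  "leaf G v \<longleftrightarrow> v \<in> verts G \<and> out_degree G v = 1"

definition isolated_vertex :: "('a, 'b) pre_digraph \<Rightarrow> 'a \<Rightarrow> bool" where
  "isolated_vertex G v \<longleftrightarrow> v \<in> verts G \<and> out_degree G v = 0"

definition strong_support_vertex :: "('a, 'b) pre_digraph \<Rightarrow> 'a \<Rightarrow> bool" where
  "strong_support_vertex G v \<longleftrightarrow>
     v \<in> verts G \<and>
     (\<exists>x y. x \<noteq> y \<and> leaf G x \<and> leaf G y \<and> v \<rightarrow>\<^bsub>G\<^esub> x \<and> v \<rightarrow>\<^bsub>G\<^esub> y)"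

inductive force_step :: "('a, 'b) pre_digraph \<Rightarrow> 'a set \<Rightarrow> 'a set \<Rightarrow> bool"
  for G :: "('a, 'b) pre_digraph" where
  force: "\<lbrakk>x \<in> S; {w. x \<rightarrow>\<^bsub>G\<^esub> w \<and> w \<notin> S} = {y}\<rbrakk> \<Longrightarrow> force_step G S (insert y S)"

definition forcing_set :: "('a, 'b) pre_digraph \<Rightarrow> 'a set \<Rightarrow> bool" where
  "forcing_set G S \<longleftrightarrow> S \<subseteq> verts G \<and> (force_step G)\<^sup>*\<^sup>* S (verts G)"

definition total_forcing_set :: "('a, 'b) pre_digraph \<Rightarrow> 'a set \<Rightarrow> bool" where
  "total_forcing_set G S \<longleftrightarrow>
     forcing_set G S \<and> \<not> (\<exists>v. isolated_vertex (G \<restriction> S) v)"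

definition total_forcing_number :: "('a, 'b) pre_digraph \<Rightarrow> nat" where
  "total_forcing_number G = (LEAST m. \<exists>S. total_forcing_set G S \<and> card S = m)"

text \<open>
  The notation \<open>K\<^bsub>1,m\<^esub> H\<close> below is the library predicate saying that \<open>H\<close> is a
  complete bipartite graph with parts of sizes 1 and \<open>m\<close>; \<open>v i\<close> is the central vertex of
  the star induced by \<open>V i\<close>.
\<close>

definition tree_family :: "nat \<Rightarrow> ('a, 'b) pre_digraph set" where
  "tree_family \<Delta> = {T. undirected_tree T \<and> max_degree T = \<Delta> \<and>
     (\<exists>(k::nat) (V :: nat \<Rightarrow> 'a set) (v :: nat \<Rightarrow> 'a).
        k \<ge> 1 \<and>
        (\<Union>i\<in>{1..k}. V i) = verts T \<and> disjoint_family_on V {1..k} \<and>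
        K\<^bsub>1,\<Delta>\<^esub> (T \<restriction> V 1) \<and>
        (\<forall>i\<in>{2..k}. K\<^bsub>1,\<Delta> - 1\<^esub> (T \<restriction> V i)) \<and>
        (\<forall>i\<in>{1..k}. v i \<in> V i \<and> \<not> leaf (T \<restriction> V i) (v i)) \<and>
        (\<forall>i\<in>{1..k}. strong_support_vertex T (v i) \<and> out_degree T (v i) = \<Delta>) \<and>
        (\<forall>i\<in>{1..k}. \<forall>j\<in>{1..k}. \<not> v i \<rightarrow>\<^bsub>T\<^esub> v j))}"

end

theory Submission
  imports Defs
begin

text \<open>
  In terms of the complement \<open>U\<close> of a total forcing set, the bound says that some \<open>U\<close> has
  \<open>\<Delta> |U| \<ge> n - 1\<close>. By induction: if some leaf \<open>z\<close> has a neighbor of degree 2, delete \<open>z\<close>, which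
  may be added to \<open>U\<close>. Otherwise, unless the tree is a star, there is a vertex \<open>v\<close> with exactly one
  non-leaf neighbor \<open>u\<close> and \<open>c \<ge> 2\<close> leaves, \<open>c + 1 \<le> \<Delta>\<close>; delete \<open>v\<close> and its leaves, one of
  which may be added to \<open>U\<close>. Equality forces \<open>c + 1 = \<Delta>\<close> and equality for the smaller tree, so
  \<open>v\<close> and its leaves form a new star of the partition. The only obstruction is a center \<open>w\<close>
  that stops being a strong support vertex since its leaf \<open>u\<close> becomes an inner vertex; then the
  forcing chain \<open>v, u, w, u'\<close> through the other leaf \<open>u'\<close> of \<open>w\<close> yields a larger \<open>U\<close>.

  Conversely, in a tree of the family the \<open>k\<close> independent centers of degree \<open>\<Delta>\<close> cover all
  \<open>k \<Delta> = n - 1\<close> edges. Being strong support vertices, they lie in every total forcing set, so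
  only they can ever force, each at most once, whence \<open>|U| \<le> k\<close>.
\<close>

section \<open>Graphs as vertex sets of a symmetric relation\<close>

lemma two_distinct_elements:
  assumes "2 \<le> card A"
  obtains x y where "x \<in> A" "y \<in> A" "x \<noteq> y"
proof -
  have "finite A" using assms by (metis card.infinite not_numeral_le_zero)
  then show ?thesis using that assms card_le_Suc0_iff_eq[of A] by fastforce
qed

locale adjacency =
  fixes E :: "'a \<Rightarrow> 'a \<Rightarrow> bool"
  assumes E_sym: "E x y \<Longrightarrow> E y x"
    and E_irrefl: "\<not> E x x"
begin

text \<open>Relative to \<open>W\<close>, so that vertices are deleted by shrinking \<open>W\<close>
  while \<open>E\<close> stays fixed.\<close>

definition nb :: "'a set \<Rightarrow> 'a \<Rightarrow> 'a set" where
  "nb W x = {y \<in> W. E x y}"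

definition pendant :: "'a set \<Rightarrow> 'a \<Rightarrow> bool" where
  "pendant W x \<longleftrightarrow> x \<in> W \<and> card (nb W x) = 1"

definition strong_support :: "'a set \<Rightarrow> 'a \<Rightarrow> bool" where
  "strong_support W c \<longleftrightarrow>
     c \<in> W \<and> (\<exists>x y. x \<noteq> y \<and> pendant W x \<and> pendant W y \<and> E c x \<and> E c y)"

text \<open>Acyclicity in the form that is inherited by subsets and yields leaves.\<close>
definition acyclic_on :: "'a set \<Rightarrow> bool" where
  "acyclic_on W \<longleftrightarrow> finite W \<and> (\<forall>U \<subseteq> W. U \<noteq> {} \<longrightarrow> (\<exists>x\<in>U. card (nb U x) \<le> 1))"

text \<open>Connectedness without walks: to use it, only a set closed under adjacency has to be
  exhibited.\<close>

definition connected_on :: "'a set \<Rightarrow> bool" where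
  "connected_on W \<longleftrightarrow> (\<forall>A \<subseteq> W. A \<noteq> {} \<longrightarrow> (\<forall>x\<in>A. nb W x \<subseteq> A) \<longrightarrow> A = W)"

definition step :: "'a set \<Rightarrow> 'a set \<Rightarrow> 'a set \<Rightarrow> bool" where
  "step W A B \<longleftrightarrow> (\<exists>x\<in>A. \<exists>y. nb W x - A = {y} \<and> B = insert y A)"

definition stalled :: "'a set \<Rightarrow> 'a set \<Rightarrow> bool" where
  "stalled W A \<longleftrightarrow> (\<forall>x\<in>A. \<forall>y. nb W x - A \<noteq> {y})"

definition forcing :: "'a set \<Rightarrow> 'a set \<Rightarrow> bool" where
  "forcing W S \<longleftrightarrow> S \<subseteq> W \<and> (step W)\<^sup>*\<^sup>* S W"

definition no_isolated :: "'a set \<Rightarrow> bool" where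
  "no_isolated S \<longleftrightarrow> (\<forall>x\<in>S. \<exists>y\<in>S. E x y)"

definition total_forcing :: "'a set \<Rightarrow> 'a set \<Rightarrow> bool" where
  "total_forcing W S \<longleftrightarrow> forcing W S \<and> no_isolated S"

text \<open>The condition \<open>2 \<le> m\<close> excludes single edges, so the center is the only
  non-leaf.\<close>

definition star :: "nat \<Rightarrow> 'a \<Rightarrow> 'a set \<Rightarrow> bool" where
  "star m c X \<longleftrightarrow> c \<in> X \<and> finite X \<and> card X = Suc m \<and> 2 \<le> m \<and>
     (\<forall>x\<in>X. \<forall>y\<in>X. E x y \<longleftrightarrow> x \<noteq> y \<and> (x = c \<or> y = c))"

definition star_partition :: "nat \<Rightarrow> 'a set \<Rightarrow> nat \<Rightarrow> (nat \<Rightarrow> 'a set) \<Rightarrow> (nat \<Rightarrow> 'a) \<Rightarrow> bool" where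
  "star_partition \<Delta> W k V v \<longleftrightarrow>
     k \<ge> 1 \<and> (\<Union>i\<in>{1..k}. V i) = W \<and> disjoint_family_on V {1..k} \<and>
     star \<Delta> (v 1) (V 1) \<and> (\<forall>i\<in>{2..k}. star (\<Delta> - 1) (v i) (V i)) \<and>
     (\<forall>i\<in>{1..k}. strong_support W (v i) \<and> card (nb W (v i)) = \<Delta>) \<and>
     (\<forall>i\<in>{1..k}. \<forall>j\<in>{1..k}. \<not> E (v i) (v j))"

text \<open>
  What remains of a star partition when only the set \<open>C\<close> of the centers is remembered.
\<close>
definition center_set :: "nat \<Rightarrow> 'a set \<Rightarrow> 'a set \<Rightarrow> bool" where
  "center_set \<Delta> W C \<longleftrightarrow> C \<subseteq> W \<and> card W = Suc (\<Delta> * card C) \<and>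
     (\<forall>c\<in>C. strong_support W c \<and> card (nb W c) = \<Delta>) \<and> (\<forall>c\<in>C. \<forall>d\<in>C. \<not> E c d)"

lemma E_commute: "E x y \<longleftrightarrow> E y x"
  using E_sym by blast

lemma nb_iff: "y \<in> nb W x \<longleftrightarrow> y \<in> W \<and> E x y"
  by (simp add: nb_def)

lemma finite_nb [simp]: "finite W \<Longrightarrow> finite (nb W x)"
  by (simp add: nb_def)

lemma nb_sym: "y \<in> nb W x \<Longrightarrow> x \<in> W \<Longrightarrow> x \<in> nb W y"
  by (simp add: nb_iff E_commute)

lemma pendant_nb: "pendant W x \<Longrightarrow> y \<in> nb W x \<Longrightarrow> nb W x = {y}"
  unfolding pendant_def by (metis card_1_singletonE singletonD)

lemma acyclic_on_finite: "acyclic_on W \<Longrightarrow> finite W"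
  by (simp add: acyclic_on_def)

lemma acyclic_on_subset: "acyclic_on W \<Longrightarrow> U \<subseteq> W \<Longrightarrow> acyclic_on U"
  unfolding acyclic_on_def by (meson finite_subset order_trans)

lemma connected_onD:
  assumes "connected_on W" "A \<subseteq> W" "A \<noteq> {}" "\<And>x y. x \<in> A \<Longrightarrow> y \<in> W \<Longrightarrow> E x y \<Longrightarrow> y \<in> A"
  shows "A = W"
proof -
  have "\<forall>x\<in>A. nb W x \<subseteq> A" using assms(4) by (auto simp: nb_iff)
  then show ?thesis using assms(1-3) by (simp add: connected_on_def)
qed

text \<open>\<open>X\<close> hangs on \<open>W'\<close> only at \<open>u\<close>. A closed set of
  \<open>W'\<close> therefore extends to a closed set of \<open>W\<close>: together with
  \<open>X\<close> if it contains \<open>u\<close>, unchanged otherwise.\<close>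

lemma connected_on_Diff:
  assumes conn: "connected_on W" and W: "W = W' \<union> X" "W' \<inter> X = {}" and "u \<in> W'"
    and att: "\<And>x y. x \<in> W' \<Longrightarrow> y \<in> X \<Longrightarrow> E x y \<Longrightarrow> x = u"
  shows "connected_on W'"
  unfolding connected_on_def
proof (intro allI impI)
  fix A assume A: "A \<subseteq> W'" "A \<noteq> {}" "\<forall>x\<in>A. nb W' x \<subseteq> A"
  define B where "B = A \<union> (if u \<in> A then X else {})"
  have "B = W"
  proof (rule connected_onD[OF conn])
    fix x y assume xy: "x \<in> B" "y \<in> W" "E x y"
    show "y \<in> B"
    proof (cases "x \<in> A")
      case xA: True
      then have xW: "x \<in> W'" using A(1) by blast
      show ?thesis
      proof (cases "y \<in> X")
        case True
        then have "u \<in> A" using att[OF xW True xy(3)] xA by simp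
        then show ?thesis using True by (simp add: B_def)
      next
        case False
        then have "y \<in> nb W' x" using xy W by (simp add: nb_iff)
        then show ?thesis using A(3) xA by (auto simp: B_def)
      qed
    next
      case False
      then have u: "u \<in> A" "x \<in> X" using xy(1) by (simp_all add: B_def split: if_splits)
      show ?thesis
      proof (cases "y \<in> X")
        case True
        then show ?thesis using u by (simp add: B_def)
      next
        case False
        then have "y = u" using att[of y x] u xy W E_sym[of x y] by blast
        then show ?thesis using u by (simp add: B_def)
      qed
    qed
  next
    show "B \<subseteq> W" using A(1) W by (auto simp: B_def)
    show "B \<noteq> {}" using A(2) by (simp add: B_def)
  qed
  then show "A = W'" using W A(1) by (auto simp: B_def split: if_splits)
qed

section \<open>Forcing and stalled sets\<close>

lemma step_subset: "(step W)\<^sup>*\<^sup>* S A \<Longrightarrow> S \<subseteq> A \<and> (S \<subseteq> W \<longrightarrow> A \<subseteq> W)"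
  by (induction rule: rtranclp_induct) (auto simp: step_def nb_def)

text \<open>By finiteness there is a maximal set reachable from \<open>S\<close>; it is stalled,
  hence all of \<open>W\<close>. Forcing is thus proved without listing a sequence of steps.\<close>

lemma forcingI:
  assumes "finite W" "S \<subseteq> W" and closed: "\<And>A. S \<subseteq> A \<Longrightarrow> A \<subseteq> W \<Longrightarrow> stalled W A \<Longrightarrow> W \<subseteq> A"
  shows "forcing W S"
proof -
  let ?R = "{A. (step W)\<^sup>*\<^sup>* S A}"
  have "?R \<subseteq> Pow W" using step_subset assms(2) by blast
  then have fin: "finite ?R" using assms(1) finite_subset by blast
  have "S \<in> ?R" by simp
  then obtain A where A: "A \<in> ?R" "\<And>B. B \<in> ?R \<Longrightarrow> A \<subseteq> B \<Longrightarrow> A = B"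
    using finite_has_maximal2[OF fin] by (metis (no_types, lifting))
  have "stalled W A"
    unfolding stalled_def
  proof (intro ballI allI notI)
    fix x y assume xy: "x \<in> A" "nb W x - A = {y}"
    then have "step W A (insert y A)" unfolding step_def by blast
    then have "insert y A \<in> ?R" using A(1) by auto
    then have "A = insert y A" using A(2) by blast
    then show False using xy(2) by blast
  qed
  moreover have "S \<subseteq> A" "A \<subseteq> W" using A(1) step_subset assms(2) by blast+
  ultimately have "A = W" using closed by blast
  then show ?thesis using A(1) assms(2) unfolding forcing_def by blast
qed

text \<open>A force replayed inside a stalled set: if uncolored, \<open>y\<close> would be the only
  uncolored neighbor of \<open>x\<close>.\<close>

lemma stalledD:
  assumes "stalled W A" "x \<in> A" "y \<in> nb W x" "nb W x \<subseteq> insert y A"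
  shows "y \<in> A"
proof (rule ccontr)
  assume "y \<notin> A"
  then have "nb W x - A = {y}" using assms by blast
  then show False using assms unfolding stalled_def by blast
qed

lemma stalled_step: "stalled W A \<Longrightarrow> step W B B' \<Longrightarrow> B \<subseteq> A \<Longrightarrow> B' \<subseteq> A"
proof -
  assume st: "stalled W A" and "step W B B'" and BA: "B \<subseteq> A"
  then obtain x y where xy: "x \<in> B" "nb W x - B = {y}" "B' = insert y B"
    unfolding step_def by blast
  have "y \<in> A"
    by (rule stalledD[OF st]) (use xy BA in auto)
  then show "B' \<subseteq> A" using xy BA by simp
qed

text \<open>No step starting inside a stalled set leaves it, so a proper stalled superset of
  \<open>S\<close> refutes forcing.\<close>

lemma forcingD:
  assumes "forcing W S" "S \<subseteq> A" "stalled W A"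
  shows "W \<subseteq> A"
proof -
  have "(step W)\<^sup>*\<^sup>* S B \<Longrightarrow> B \<subseteq> A" for B
    by (induction rule: rtranclp_induct) (use assms stalled_step in auto)
  then show ?thesis using assms(1) unfolding forcing_def by blast
qed

lemma stalledI:
  assumes "\<And>x y. x \<in> A \<Longrightarrow> y \<in> nb W x \<Longrightarrow> nb W x \<subseteq> insert y A \<Longrightarrow> y \<in> A"
  shows "stalled W A"
  unfolding stalled_def using assms by blast

section \<open>The lower bound for the family\<close>

text \<open>Handshake form of the fact that a forest has fewer edges than vertices. Deleting a
  vertex of degree at most 1 lowers the degree sum by twice that degree.\<close>

lemma sum_card_nb_le:
  assumes "acyclic_on W" "W \<noteq> {}"
  shows "(\<Sum>x\<in>W. card (nb W x)) + 2 \<le> 2 * card W"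
  using assms
proof (induction "card W" arbitrary: W)
  case 0
  then show ?case using acyclic_on_finite by auto
next
  case (Suc n)
  have fin: "finite W" using Suc by (simp add: acyclic_on_finite)
  obtain x where x: "x \<in> W" "card (nb W x) \<le> 1"
    using Suc.prems unfolding acyclic_on_def by blast
  let ?U = "W - {x}"
  have nbU: "card (nb W y) = card (nb ?U y) + (if E x y then 1 else 0)" if "y \<in> ?U" for y
  proof (cases "E x y")
    case True
    then have "nb W y = insert x (nb ?U y)" "x \<notin> nb ?U y" using x that E_commute[of x y] by (auto simp: nb_iff)
    then show ?thesis using fin True by simp
  next
    case False
    then have "nb W y = nb ?U y" using x that E_commute[of x y] by (auto simp: nb_iff)
    then show ?thesis using False by simp
  qed
  have ind: "(\<Sum>y\<in>?U. if E x y then 1 else 0 :: nat) = card (nb W x)"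
  proof -
    have "nb W x = {y \<in> ?U. E x y}" using E_irrefl by (auto simp: nb_def)
    then show ?thesis using fin by (simp add: sum.If_cases Int_def)
  qed
  have "(\<Sum>y\<in>W. card (nb W y)) = card (nb W x) + (\<Sum>y\<in>?U. card (nb W y))"
    using fin x by (simp add: sum.remove)
  also have "(\<Sum>y\<in>?U. card (nb W y)) = (\<Sum>y\<in>?U. card (nb ?U y)) + card (nb W x)"
    using nbU ind by (simp add: sum.distrib)
  finally have eq: "(\<Sum>y\<in>W. card (nb W y)) = (\<Sum>y\<in>?U. card (nb ?U y)) + 2 * card (nb W x)"
    by simp
  show ?case
  proof (cases "?U = {}")
    case True
    then have "W = {x}" using x by blast
    then show ?thesis using E_irrefl by (simp add: nb_def)
  next
    case False
    have "(\<Sum>y\<in>?U. card (nb ?U y)) + 2 \<le> 2 * card ?U"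
      using Suc.hyps x False acyclic_on_subset[OF Suc.prems(1)] fin by (intro Suc.hyps(1)) auto
    then show ?thesis using eq x(2) fin x(1) Suc.hyps(2) by simp
  qed
qed

text \<open>The forest has at most \<open>\<Delta> * card C\<close> edges, and the independent
  centers of degree \<open>\<Delta>\<close> already account for that many. An edge avoiding
  \<open>C\<close> would be one too many.\<close>

lemma center_set_cover:
  assumes ac: "acyclic_on W" and C: "center_set \<Delta> W C" and x: "x \<in> W" "x \<notin> C"
  shows "nb W x \<subseteq> C"
proof (rule ccontr)
  assume not: "\<not> nb W x \<subseteq> C"
  note fin = acyclic_on_finite[OF ac]
  have CW: "C \<subseteq> W" and finC: "finite C" using C fin finite_subset unfolding center_set_def by auto
  have degC: "(\<Sum>c\<in>C. card (nb W c)) = \<Delta> * card C" using C unfolding center_set_def by simp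
  have "(\<Sum>x\<in>W. card (nb W x)) = (\<Sum>x\<in>W - C. card (nb W x)) + \<Delta> * card C"
    using sum.subset_diff[OF CW fin, of "\<lambda>x. card (nb W x)"] degC by simp
  then have ub: "(\<Sum>x\<in>W - C. card (nb W x)) \<le> \<Delta> * card C"
    using sum_card_nb_le[OF ac] x C unfolding center_set_def by auto
  have "nb C y \<subseteq> nb W y" for y using CW by (auto simp: nb_iff)
  then have le: "card (nb C y) \<le> card (nb W y)" for y using fin by (simp add: card_mono)
  have "nb C x \<subset> nb W x" using not CW by (auto simp: nb_iff)
  then have less: "card (nb C x) < card (nb W x)" using fin by (simp add: psubset_card_mono)
  \<comment> \<open>Double counting of the edges between \<open>C\<close> and its complement; by
    independence every neighbor of a center lies outside \<open>C\<close>.\<close>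
  have "(\<Sum>x\<in>W - C. card (nb C x)) = (\<Sum>c\<in>C. card (nb W c))"
    unfolding nb_def
  proof (rule sum_multicount_gen)
    show "\<forall>c\<in>C. card {x \<in> W - C. E x c} = card {y \<in> W. E c y}"
    proof
      fix c assume "c \<in> C"
      then have "{x \<in> W - C. E x c} = {y \<in> W. E c y}"
        using C E_commute[of _ c] unfolding center_set_def by auto
      then show "card {x \<in> W - C. E x c} = card {y \<in> W. E c y}" by simp
    qed
  qed (use fin finC in auto)
  moreover have "(\<Sum>x\<in>W - C. card (nb C x)) < (\<Sum>x\<in>W - C. card (nb W x))"
    by (rule sum_strict_mono_ex1) (use fin le less x in auto)
  ultimately show False using ub degC by simp
qed

lemma star_partition_center_set:
  assumes "star_partition \<Delta> W k V v"
  shows "center_set \<Delta> W (v ` {1..k})" "card (v ` {1..k}) = k" 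
proof -
  note P = assms[unfolded star_partition_def]
  have k: "k \<ge> 1" using P by simp
  have st: "star \<Delta> (v 1) (V 1)" "\<And>i. i \<in> {2..k} \<Longrightarrow> star (\<Delta> - 1) (v i) (V i)" using P by auto
  have D: "\<Delta> \<ge> 2" using st(1) by (simp add: star_def)
  have vV: "v i \<in> V i \<and> finite (V i)" if "i \<in> {1..k}" for i
    using st that by (cases "i = 1") (auto simp: star_def)
  have dis: "V i \<inter> V j = {}" if "i \<in> {1..k}" "j \<in> {1..k}" "i \<noteq> j" for i j
    using P that by (auto simp: disjoint_family_on_def)
  have "inj_on v {1..k}"
  proof (rule inj_onI)
    fix i j assume "i \<in> {1..k}" "j \<in> {1..k}" "v i = v j"
    then show "i = j" using vV[of i] vV[of j] dis[of i j] by (metis IntI empty_iff)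
  qed
  then show card: "card (v ` {1..k}) = k" by (simp add: card_image)
  have "card W = (\<Sum>i\<in>{1..k}. card (V i))"
    using P vV dis by (metis card_UN_disjoint finite_atLeastAtMost)
  \<comment> \<open>The first star has one vertex more than the others, whence the
    \<open>Suc\<close> in \<open>center_set\<close>.\<close>
  also have "{1..k} = insert 1 {2..k}" using k by auto
  also have "(\<Sum>i\<in>insert 1 {2..k}. card (V i)) = card (V 1) + (\<Sum>i\<in>{2..k}. card (V i))"
    by simp
  also have "card (V 1) = Suc \<Delta>" using st(1) by (simp add: star_def)
  also have "(\<Sum>i\<in>{2..k}. card (V i)) = (\<Sum>i\<in>{2..k}. \<Delta>)"
    by (rule sum.cong) (use st(2) D in \<open>auto simp: star_def\<close>)
  finally have "card W = Suc (\<Delta> * k)" using k by (cases k) (simp_all add: algebra_simps)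
  then show "center_set \<Delta> W (v ` {1..k})"
    using P vV card unfolding center_set_def by auto
qed

lemma card_Diff_total_forcing_le:
  assumes ac: "acyclic_on W" and C: "center_set \<Delta> W C" and S: "total_forcing W S"
  shows "card (W - S) \<le> card C"
proof -
  note fin = acyclic_on_finite[OF ac]
  have SW: "S \<subseteq> W" and steps: "(step W)\<^sup>*\<^sup>* S W" and tot: "no_isolated S"
    using S unfolding total_forcing_def forcing_def by auto
  have CW: "C \<subseteq> W" and finC: "finite C" using C fin finite_subset unfolding center_set_def by auto
  have CS: "C \<subseteq> S"
  proof
    fix c assume "c \<in> C"
    then obtain x y where xy: "x \<noteq> y" "pendant W x" "pendant W y" "E c x" "E c y" "c \<in> W"
      using C unfolding center_set_def strong_support_def by blast
    have nx: "nb W x = {c}" and ny: "nb W y = {c}"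
      using xy E_commute[of c] by (auto intro!: pendant_nb simp: nb_iff)
    have "x \<in> S \<or> y \<in> S"
    proof (rule ccontr)
      assume no: "\<not> (x \<in> S \<or> y \<in> S)"
      \<comment> \<open>Only \<open>c\<close> is adjacent to \<open>x\<close> or \<open>y\<close>,
        and it is adjacent to both, so neither can be forced.\<close>
      have "stalled W (W - {x, y})"
      proof (rule stalledI)
        fix z t assume zt: "z \<in> W - {x, y}" "t \<in> nb W z" "nb W z \<subseteq> insert t (W - {x, y})"
        show "t \<in> W - {x, y}"
        proof (rule ccontr)
          assume "t \<notin> W - {x, y}"
          then have "t = x \<or> t = y" using zt by (auto simp: nb_iff)
          then have "z = c" using zt nx ny nb_sym[of t W z] by auto
          then have "x \<in> nb W z" "y \<in> nb W z" using xy by (auto simp: nb_iff pendant_def)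
          then show False using zt xy(1) by auto
        qed
      qed
      moreover have "forcing W S" using S by (simp add: total_forcing_def)
      moreover have "S \<subseteq> W - {x, y}" using no SW by blast
      ultimately have "W \<subseteq> W - {x, y}" by (rule forcingD[rotated -1])
      moreover have "x \<in> W" using xy by (simp add: pendant_def)
      ultimately show False by blast
    qed
    \<comment> \<open>A colored leaf needs a colored neighbor, and \<open>c\<close> is its only
      neighbor.\<close>
    then obtain z where "z \<in> S" "nb W z = {c}" using nx ny by blast
    moreover obtain t where "t \<in> S" "E z t" using tot \<open>z \<in> S\<close> unfolding no_isolated_def by blast
    moreover have "t \<in> nb W z" using \<open>t \<in> S\<close> \<open>E z t\<close> SW by (auto simp: nb_iff)
    ultimately show "c \<in> S" by simp
  qed
  \<comment> \<open>Each forced vertex is charged to the center that forces it: the force completes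
    the neighborhood of that center, which was incomplete before.\<close>
  have "card (A - S) \<le> card {c \<in> C. nb W c \<subseteq> A}" if "(step W)\<^sup>*\<^sup>* S A" for A
    using that
  proof (induction rule: rtranclp_induct)
    case base
    then show ?case by simp
  next
    case (step A B)
    have SA: "S \<subseteq> A" "A \<subseteq> W" using step.hyps(1) step_subset SW by blast+
    obtain x y where xy: "x \<in> A" "nb W x - A = {y}" "B = insert y A"
      using step.hyps(2) unfolding step_def by blast
    \<comment> \<open>A vertex outside \<open>C\<close> has only centers as neighbors, and these are
      colored from the start.\<close>
    have "x \<in> C"
      using center_set_cover[OF ac C, of x] xy SA CS by blast
    have sub: "{c \<in> C. nb W c \<subseteq> A} \<subset> {c \<in> C. nb W c \<subseteq> B}"
      using \<open>x \<in> C\<close> xy by blast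
    have "card (B - S) \<le> Suc (card (A - S))"
      using xy(3) SA(2) fin finite_subset[of A W] by (simp add: insert_Diff_if card_insert_if)
    also have "\<dots> \<le> Suc (card {c \<in> C. nb W c \<subseteq> A})" using step.IH by simp
    also have "\<dots> \<le> card {c \<in> C. nb W c \<subseteq> B}"
      using psubset_card_mono[OF _ sub] finC by simp
    finally show ?case .
  qed
  from this[OF steps] show ?thesis
    using card_mono[OF finC, of "{c \<in> C. nb W c \<subseteq> W}"] by auto
qed

section \<open>The upper bound\<close>

text \<open>The reducible configuration: \<open>insert v L\<close> is joined to the rest only by the
  edge from \<open>v\<close> to \<open>u\<close>.\<close>

definition pendant_star :: "'a set \<Rightarrow> 'a \<Rightarrow> 'a \<Rightarrow> 'a set \<Rightarrow> bool" where
  "pendant_star W u v L \<longleftrightarrow> finite W \<and> v \<in> W \<and> u \<in> W \<and> nb W v = insert u L \<and> u \<notin> L \<and>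
     (\<forall>l\<in>L. nb W l = {v})"

text \<open>Everything except one leaf \<open>l\<close> is colored: the center forces
  \<open>l\<close>, and a second leaf \<open>l'\<close> keeps the center from being
  isolated.\<close>

lemma star_total_forcing:
  assumes "star m c W"
  shows "\<exists>S. total_forcing W S \<and> card (W - S) = 1"
proof -
  have c: "c \<in> W" and fin: "finite W" and E: "\<And>x y. x \<in> W \<Longrightarrow> y \<in> W \<Longrightarrow> E x y \<longleftrightarrow> x \<noteq> y \<and> (x = c \<or> y = c)"
    and "card (W - {c}) \<ge> 2"
    using assms by (auto simp: star_def)
  then obtain l l' where l: "l \<in> W - {c}" "l' \<in> W - {c}" "l \<noteq> l'"
    using two_distinct_elements by metis
  have "total_forcing W (W - {l})"
    unfolding total_forcing_def
  proof
    show "forcing W (W - {l})"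
    proof (rule forcingI[OF fin])
      fix A assume A: "W - {l} \<subseteq> A" "stalled W A"
      have "l \<in> A"
        by (rule stalledD[OF A(2), of c]) (use A l c E in \<open>auto simp: nb_iff\<close>)
      then show "W \<subseteq> A" using A by blast
    qed simp
    show "no_isolated (W - {l})"
      unfolding no_isolated_def
    proof
      fix x assume x: "x \<in> W - {l}"
      show "\<exists>y\<in>W - {l}. E x y"
      proof (cases "x = c")
        case True
        then show ?thesis using l c E[of c l'] by (intro bexI[of _ l']) auto
      next
        case False
        then show ?thesis using l c x E[of x c] by (intro bexI[of _ c]) auto
      qed
    qed
  qed
  moreover have "W - (W - {l}) = {l}" using l by blast
  ultimately show ?thesis by (intro exI[of _ "W - {l}"]) simp
qed

text \<open>The same \<open>S\<close> serves both trees, so \<open>z\<close> joins the complement.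
  Among the vertices that remain, only \<open>v\<close> has a different neighborhood in the smaller
  tree.\<close>

lemma total_forcing_insert_pendant:
  assumes fin: "finite W" and z: "z \<in> W" "nb W z = {v}" and v: "nb W v = {u, z}" "u \<noteq> z"
    and S: "total_forcing (W - {z}) S"
  shows "total_forcing W S"
proof -
  let ?W = "W - {z}"
  have SW: "S \<subseteq> ?W" and fS: "forcing ?W S" and tot: "no_isolated S"
    using S unfolding total_forcing_def forcing_def by auto
  have vW: "v \<in> W" "u \<in> W" using z v nb_iff[of v W z] nb_iff[of u W v] by simp_all
  have nbx: "nb ?W x = nb W x" if "x \<noteq> v" "x \<in> W" for x
  proof -
    have "z \<notin> nb W x" using that z nb_sym[of z W x] by blast
    then show ?thesis by (auto simp: nb_iff)
  qed
  have "forcing W S"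
  proof (rule forcingI[OF fin])
    fix A assume A: "S \<subseteq> A" "A \<subseteq> W" "stalled W A"
    \<comment> \<open>In \<open>?W\<close> the leaf \<open>v\<close> could force \<open>u\<close>, but \<open>u\<close> is colored before \<open>v\<close>: if \<open>v \<in> S\<close> then \<open>u \<in> S\<close>.\<close>
    have uA: "u \<in> A"
    proof (rule ccontr)
      assume u: "u \<notin> A"
      have "v \<notin> S"
      proof
        assume "v \<in> S"
        then obtain y where "y \<in> S" "E v y" using tot unfolding no_isolated_def by blast
        then have "y \<in> nb W v" "y \<noteq> z" using SW by (auto simp: nb_iff)
        then show False using u A \<open>y \<in> S\<close> v by auto
      qed
      \<comment> \<open>While \<open>u\<close> is uncolored, only \<open>z\<close> can be a vertex
        of \<open>A\<close> adjacent to \<open>v\<close>, so dropping \<open>v\<close> and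
        \<open>z\<close> enables no new force in \<open>?W\<close>.\<close>
      have "stalled ?W (A - {v, z})"
      proof (rule stalledI)
        fix x y assume xy: "x \<in> A - {v, z}" "y \<in> nb ?W x" "nb ?W x \<subseteq> insert y (A - {v, z})"
        then have xW: "x \<in> W" "x \<noteq> v" using A by auto
        then have y: "y \<in> nb W x" using xy nbx by simp
        have "y \<noteq> v"
        proof
          assume "y = v"
          then have "x \<in> nb W v" using nb_sym[OF y xW(1)] by simp
          then show False using u xy(1) v by auto
        qed
        moreover have "y \<in> A"
          by (rule stalledD[OF A(3), of x]) (use xy y nbx[OF xW(2,1)] in auto)
        moreover have "y \<noteq> z" using xy(2) by (simp add: nb_iff)
        ultimately show "y \<in> A - {v, z}" by simp
      qed
      moreover have "S \<subseteq> A - {v, z}" using A(1) SW \<open>v \<notin> S\<close> by blast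
      ultimately have "?W \<subseteq> A - {v, z}" using forcingD[OF fS] by blast
      then show False using u vW v by blast
    qed
    \<comment> \<open>With \<open>u\<close> colored, \<open>v\<close> has nothing left to force in
      \<open>?W\<close>; every other vertex has the same neighbors as in \<open>W\<close>.\<close>
    have "stalled ?W A"
    proof (rule stalledI)
      fix x y assume xy: "x \<in> A" "y \<in> nb ?W x" "nb ?W x \<subseteq> insert y A"
      show "y \<in> A"
      proof (cases "x = v")
        case True
        then have "y \<in> nb W v" "y \<noteq> z" using xy by (auto simp: nb_iff)
        then show ?thesis using v uA by auto
      next
        case False
        have "nb ?W x = nb W x" using nbx[OF False] xy(1) A(2) by blast
        then show ?thesis using stalledD[OF A(3), of x y] xy by simp
      qed
    qed
    then have WA: "?W \<subseteq> A" using forcingD[OF fS] A(1) by blast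
    moreover have "z \<in> A"
    proof (rule stalledD[OF A(3)])
      show "v \<in> A" using WA vW z E_irrefl by (auto simp: nb_def)
    qed (use v uA in auto)
    ultimately show "W \<subseteq> A" by blast
  qed (use SW in blast)
  then show ?thesis using tot by (simp add: total_forcing_def)
qed

section \<open>Deleting a pendant star: \<open>v\<close> together with its leaves
  \<open>L\<close>\<close>

context
  fixes W u v L W'
  assumes ps: "pendant_star W u v L" and W': "W' = W - insert v L"
begin

lemma pendant_star_simps:
  shows "finite W" "v \<in> W" "u \<in> W" "nb W v = insert u L" "u \<notin> L" "l \<in> L \<Longrightarrow> nb W l = {v}"
    and "L \<subseteq> W" "finite L" "v \<notin> L" "u \<noteq> v" "u \<in> W'" "W' \<subseteq> W" "finite W'"
    and "W = W' \<union> insert v L" "W' \<inter> insert v L = {}"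
    and "card W = card W' + Suc (card L)"
proof -
  show *: "finite W" "v \<in> W" "u \<in> W" "nb W v = insert u L" "u \<notin> L" "l \<in> L \<Longrightarrow> nb W l = {v}"
    using ps unfolding pendant_star_def by auto
  have "v \<notin> nb W v" "nb W v \<subseteq> W" using E_irrefl by (auto simp: nb_iff)
  then show **: "L \<subseteq> W" "v \<notin> L" "u \<noteq> v" using *(4) by auto
  then show "finite L" using *(1) finite_subset by blast
  show "u \<in> W'" "W' \<subseteq> W" "finite W'" "W = W' \<union> insert v L" "W' \<inter> insert v L = {}"
    using * ** W' by auto
  have "card W = card W' + card (insert v L)"
    using * ** W' \<open>finite L\<close> by (metis card_Diff_subset card_mono finite_insert insert_subset le_add_diff_inverse2)
  then show "card W = card W' + Suc (card L)" using ** \<open>finite L\<close> by simp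
qed

lemma pendant_star_nb_v: "x \<in> W' \<Longrightarrow> x \<noteq> u \<Longrightarrow> nb W x = nb W' x"
  and pendant_star_nb_u: "nb W u = insert v (nb W' u)"
proof -
  note S = pendant_star_simps
  have L: "nb W x \<inter> L = {}" if "x \<in> W'" for x
  proof -
    have "y \<notin> nb W x" if "y \<in> L" for y
      using nb_sym[of y W x] S(6)[OF that] S(12,15) \<open>x \<in> W'\<close> by auto
    then show ?thesis by blast
  qed
  show "nb W x = nb W' x" if x: "x \<in> W'" "x \<noteq> u"
  proof -
    have "v \<notin> nb W x" using nb_sym[of v W x] x S(4,12,15) by auto
    then show ?thesis using L[OF x(1)] W' by (auto simp: nb_iff)
  qed
  have "v \<in> nb W u" using nb_sym[of u W v] S(2,4) by simp
  then show "nb W u = insert v (nb W' u)" using L[OF S(11)] W' by (auto simp: nb_iff)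
qed

lemma pendant_star_connected_on:
  assumes "connected_on W"
  shows "connected_on W'"
proof (rule connected_on_Diff[OF assms pendant_star_simps(14,15,11)])
  fix x y assume xy: "x \<in> W'" "y \<in> insert v L" "E x y"
  show "x = u"
  proof (rule ccontr)
    assume "x \<noteq> u"
    then have "nb W x = nb W' x" using pendant_star_nb_v xy by simp
    moreover have "y \<in> nb W x" using xy pendant_star_simps(14) by (auto simp: nb_iff)
    ultimately have "y \<in> W'" by (simp add: nb_iff)
    then show False using xy(2) pendant_star_simps(15) by blast
  qed
qed

text \<open>Color \<open>v\<close> and all of \<open>L\<close> except \<open>l\<close>. Being
  colored from the start, \<open>v\<close> hinders no force inside \<open>W'\<close>, and it forces
  \<open>l\<close> once \<open>u\<close> is colored. The leaf \<open>l'\<close> keeps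
  \<open>v\<close> from being isolated.\<close>

lemma pendant_star_total_forcing:
  assumes L2: "2 \<le> card L" and S: "total_forcing W' S"
  shows "\<exists>S'. total_forcing W S' \<and> card (W - S') = Suc (card (W' - S))"
proof -
  note P = pendant_star_simps
  have SW: "S \<subseteq> W'" and fS: "forcing W' S" and tot: "no_isolated S"
    using S unfolding total_forcing_def forcing_def by auto
  obtain l l' where l: "l \<in> L" "l' \<in> L" "l \<noteq> l'"
    using L2 two_distinct_elements by metis
  let ?S = "S \<union> insert v (L - {l})"
  have "forcing W ?S"
  proof (rule forcingI[OF P(1)])
    show "?S \<subseteq> W" using SW P(14) by blast
    fix A assume A: "?S \<subseteq> A" "A \<subseteq> W" "stalled W A"
    have vA: "v \<in> A" using A by blast
    have "stalled W' (A \<inter> W')"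
    proof (rule stalledI)
      fix x y assume xy: "x \<in> A \<inter> W'" "y \<in> nb W' x" "nb W' x \<subseteq> insert y (A \<inter> W')"
      then have "nb W x \<subseteq> insert v (nb W' x)" using pendant_star_nb_v pendant_star_nb_u by blast
      moreover have "y \<in> nb W x" "y \<in> W'" using xy P(12) by (auto simp: nb_iff)
      moreover have "nb W x \<subseteq> insert y A" using calculation(1) xy(3) vA by blast
      ultimately show "y \<in> A \<inter> W'"
        using stalledD[OF A(3), of x y] xy(1) by simp
    qed
    moreover have "S \<subseteq> A \<inter> W'" using A(1) SW by blast
    ultimately have W'A: "W' \<subseteq> A" using forcingD[OF fS] by blast
    have "l \<in> A"
      by (rule stalledD[OF A(3) vA]) (use l P(4,11) A(1) W'A in auto)
    then show "W \<subseteq> A" using W'A A(1) P(14) by blast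
  qed
  moreover have "no_isolated ?S"
    unfolding no_isolated_def
  proof
    fix x assume x: "x \<in> ?S"
    have Ev: "E v y" if "y \<in> L" for y using P(4) that nb_iff[of y W v] by simp
    consider "x \<in> S" | "x = v" | "x \<in> L" using x by blast
    then show "\<exists>y\<in>?S. E x y"
    proof cases
      case 1
      then show ?thesis using tot unfolding no_isolated_def by blast
    next
      case 2
      then show ?thesis using l Ev[OF l(2)] by blast
    next
      case 3
      then show ?thesis using E_sym[OF Ev] by blast
    qed
  qed
  moreover have "W - ?S = insert l (W' - S)" using P(5,9,14,15) SW l by blast
  moreover have "l \<notin> W' - S" using l P(15) by blast
  ultimately show ?thesis
    using P(13) unfolding total_forcing_def by (intro exI[of _ ?S]) simp
qed

text \<open>In \<open>W'\<close> the vertex \<open>w\<close> has just two leaves, \<open>u\<close>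
  and \<open>u'\<close>, and in \<open>W\<close> the vertex \<open>u\<close> links \<open>v\<close>
  to \<open>w\<close>. Uncolored are \<open>u\<close>, \<open>w\<close>, \<open>u'\<close> and one
  leaf of each other center, which makes \<open>3 + (card C - 1)\<close> vertices; \<open>u'\<close>
  is forced last.\<close>

lemma pendant_star_lost_support:
  assumes ac: "acyclic_on W" and conn: "connected_on W" and L2: "2 \<le> card L" and C: "center_set \<Delta> W' C"
    and u: "u \<notin> C" and w: "w \<in> C" "\<not> strong_support W w"
  shows "\<exists>S. total_forcing W S \<and> card (W - S) = card C + 2"
proof -
  note P = pendant_star_simps
  have acW': "acyclic_on W'" using ac P(12) acyclic_on_subset by blast
  have CW: "C \<subseteq> W'" and supp: "\<And>c. c \<in> C \<Longrightarrow> strong_support W' c"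
    and ind: "\<And>c d. c \<in> C \<Longrightarrow> d \<in> C \<Longrightarrow> \<not> E c d"
    using C by (auto simp: center_set_def)
  have finC: "finite C" using CW P(13) finite_subset by blast
  have nbw: "nb W c = nb W' c" if "c \<in> C" for c
    using pendant_star_nb_v[of c] that CW u by blast
  have pend: "nb W' p = {c}" if "pendant W' p" "E c p" "c \<in> W'" for p c
    using that E_sym[of c p] by (intro pendant_nb) (auto simp: nb_iff)
  have pendW: "pendant W p" if "pendant W' p" "p \<noteq> u" for p
    using that pendant_star_nb_v[of p] P(12) by (auto simp: pendant_def)
  have wW: "w \<in> W'" "w \<in> W" using w CW P(12) by auto
  \<comment> \<open>Two leaves of \<open>w\<close> different from \<open>u\<close> would still be
    leaves in \<open>W\<close> and preserve its support.\<close>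
  have two: "p = u \<or> q = u" if "pendant W' p" "pendant W' q" "E w p" "E w q" "p \<noteq> q" for p q
    using that pendW w(2) wW unfolding strong_support_def by blast
  obtain u' where u': "pendant W' u" "pendant W' u'" "E w u" "E w u'" "u \<noteq> u'"
    using supp[OF w(1)] two unfolding strong_support_def by metis
  have only: "p = u \<or> p = u'" if "pendant W' p" "E w p" for p
    using two[of p u'] that u' by blast
  have nbu: "nb W u = {v, w}" using pendant_star_nb_u pend[OF u'(1,3) wW(1)] by simp
  have "\<exists>p q. pendant W' p \<and> E c p \<and> pendant W' q \<and> E c q \<and> p \<noteq> q" if "c \<in> C" for c
    using supp[OF that] unfolding strong_support_def by metis
  \<comment> \<open>Of two leaves at each center, \<open>f c\<close> will be left uncolored, while
    \<open>g c\<close> stays colored so that \<open>c\<close> is not isolated.\<close>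
  then obtain f g where fg: "\<And>c. c \<in> C \<Longrightarrow> pendant W' (f c) \<and> E c (f c) \<and> pendant W' (g c) \<and> E c (g c) \<and> f c \<noteq> g c"
    by metis
  let ?D = "C - {w}"
  let ?U = "insert u (insert w (insert u' (f ` ?D)))"
  let ?S = "W - ?U"
  have nbf: "nb W' (f c) = {c}" "nb W' (g c) = {c}" if "c \<in> C" for c
    using pend fg[OF that] that CW by blast+
  have nbu': "nb W' u = {w}" "nb W' u' = {w}" using pend u' wW by blast+
  have nC: "p \<notin> C" if "pendant W' p" "E c p" "c \<in> C" for c p
    using that ind by blast
  have inj: "inj_on f ?D" using nbf(1) by (metis Diff_iff inj_onI singleton_inject)
  have f_ne: "f c \<noteq> u" "f c \<noteq> u'" "f c \<notin> C" "f c \<in> W'" if "c \<in> ?D" for c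
    using nbf(1)[of c] nbu' that fg[of c] ind[of c "f c"] by (auto simp: pendant_def)
  have g_ne: "g c \<notin> ?U" if c: "c \<in> ?D" for c
  proof
    assume "g c \<in> ?U"
    moreover have "g c \<noteq> u" "g c \<noteq> u'" using nbf(2)[of c] nbu' c by auto
    moreover have "g c \<noteq> w" using fg[of c] ind[of c w] w c by auto
    ultimately obtain d where d: "d \<in> ?D" "g c = f d" by blast
    then have "c = d" using nbf(1)[of d] nbf(2)[of c] c by auto
    then show False using d(2) fg[of c] c by auto
  qed
  have UW: "?U \<subseteq> W'" using P(11) wW u'(2) f_ne by (auto simp: pendant_def)
  have LS: "insert v L \<subseteq> ?S" using UW P(2,7,15) by blast
  have "u' \<notin> C" using ind[OF w(1)] u'(4) by blast
  have cardU: "card ?U = card C + 2"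
  proof -
    have "u \<notin> insert w (insert u' (f ` ?D))" using u u' w f_ne(1) by auto
    moreover have "w \<notin> insert u' (f ` ?D)" using \<open>u' \<notin> C\<close> w f_ne(3) by auto
    moreover have "u' \<notin> f ` ?D" using f_ne(2) by auto
    moreover have "card (f ` ?D) = card ?D" "Suc (card ?D) = card C"
      using card_image[OF inj] card_Suc_Diff1[OF finC w(1)] by simp_all
    ultimately show ?thesis using finC by simp
  qed
  have cov: "nb W' x \<subseteq> C" if "x \<in> W'" "x \<notin> C" for x
    using center_set_cover[OF acW' C] that by blast
  have "forcing W ?S"
  proof (rule forcingI[OF P(1)])
    fix A assume A: "?S \<subseteq> A" "A \<subseteq> W" "stalled W A"
    have vA: "v \<in> A" "L \<subseteq> A" using A(1) LS by blast+
    have uA: "u \<in> A" by (rule stalledD[OF A(3) vA(1)]) (use P(4) vA in auto)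
    have wA: "w \<in> A" by (rule stalledD[OF A(3) uA]) (use nbu vA in auto)
    have fA: "f c \<in> A" if c: "c \<in> ?D" for c
    proof (rule stalledD[OF A(3)])
      have "c \<notin> ?U" using c u \<open>u' \<notin> C\<close> f_ne(3) by auto
      then show "c \<in> A" using A(1) c CW P(12) by blast
      show fc: "f c \<in> nb W c" using nbw c f_ne(4) fg by (auto simp: nb_iff)
      \<comment> \<open>Of \<open>?U\<close>, only \<open>f c\<close> is adjacent to
        \<open>c\<close>: \<open>u\<close>, \<open>u'\<close> and the other chosen leaves hang on
        different centers, and \<open>w\<close> is itself a center.\<close>
      show "nb W c \<subseteq> insert (f c) A"
      proof
        fix y assume y: "y \<in> nb W c"
        then have "y \<in> W'" "E c y" "y \<in> W" using nbw[of c] c nb_iff[of y W' c] nb_iff[of y W c] by auto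
        then have cy: "c \<in> nb W' y" using c CW E_sym by (auto simp: nb_iff)
        have "y \<noteq> u" "y \<noteq> u'" using cy nbu' c by auto
        moreover have "y \<noteq> w" using ind[of c w] c w \<open>E c y\<close> by auto
        moreover have "y = f c" if "y = f d" "d \<in> ?D" for d
          using cy nbf(1)[of d] that by auto
        ultimately show "y \<in> insert (f c) A" using A(1) \<open>y \<in> W\<close> by blast
      qed
    qed
    have "u' \<in> A"
    proof (rule stalledD[OF A(3) wA])
      show "u' \<in> nb W w" using nbw[OF w(1)] u' by (auto simp: nb_iff pendant_def)
      show "nb W w \<subseteq> insert u' A"
      proof
        fix y assume "y \<in> nb W w"
        then have "y \<in> W" "y \<noteq> w" using E_irrefl by (auto simp: nb_iff)
        then show "y \<in> insert u' A" using A(1) uA fA by blast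
      qed
    qed
    then show "W \<subseteq> A" using A(1) uA wA fA by blast
  qed simp
  moreover have "no_isolated ?S"
    unfolding no_isolated_def
  proof
    fix x assume x: "x \<in> ?S"
    have Ev: "E v y" if "y \<in> L" for y using P(4) that nb_iff[of y W v] by simp
    consider "x = v" | "x \<in> L" | "x \<in> W'" "x \<in> C" | "x \<in> W'" "x \<notin> C" using x P(14) by blast
    then show "\<exists>y\<in>?S. E x y"
    proof cases
      case 1
      obtain l where "l \<in> L" using L2 by fastforce
      then show ?thesis using 1 Ev LS by blast
    next
      case 2
      then show ?thesis using Ev LS E_sym[of v x] by blast
    next
      case 3
      then have xD: "x \<in> ?D" using x by blast
      have "g x \<in> W" using fg[OF 3(2)] P(12) by (auto simp: pendant_def)
      then show ?thesis using fg[OF 3(2)] g_ne[OF xD] by blast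
    next
      case 4
      \<comment> \<open>By connectedness \<open>x\<close> has a neighbor, necessarily a center. If
        \<open>w\<close> were the only one, \<open>x\<close> would be a leaf at \<open>w\<close>, so
        \<open>u\<close> or \<open>u'\<close>, both in \<open>?U\<close>.\<close>
      have "\<exists>c\<in>C. c \<noteq> w \<and> E x c"
      proof (rule ccontr)
        assume no: "\<not> ?thesis"
        then have "nb W' x \<subseteq> {w}" using cov[OF 4] by (auto simp: nb_iff)
        moreover have "nb W' x \<noteq> {}"
        proof
          assume "nb W' x = {}"
          then have "{x} = W'"
            by (intro connected_onD[OF pendant_star_connected_on[OF conn]]) (use 4 in \<open>auto simp: nb_iff\<close>)
          then show False using wW(1) w(1) 4 by blast
        qed
        ultimately have "nb W' x = {w}" by blast
        then have "pendant W' x" "E w x"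
          using 4 E_commute[of w x] nb_iff[of w W' x] by (simp_all add: pendant_def)
        then show False using only[of x] x by blast
      qed
      then obtain c where c: "c \<in> ?D" "E x c" by blast
      then have "c \<notin> ?U" using u \<open>u' \<notin> C\<close> f_ne(3) by auto
      then show ?thesis using c CW P(12) by blast
    qed
  qed
  moreover have "W - ?S = ?U" using UW P(12) by blast
  ultimately show ?thesis
    using cardU unfolding total_forcing_def by (intro exI[of _ ?S]) simp
qed

text \<open>As \<open>u\<close> is no center, the old centers keep their degrees and are not
  adjacent to \<open>v\<close>. Their strong support is assumed separately, since \<open>u\<close>
  may have been a leaf at one of them.\<close>

lemma pendant_star_star_partition:
  assumes P': "star_partition \<Delta> W' k V c" and L2: "2 \<le> card L" "Suc (card L) = \<Delta>"
    and u: "u \<notin> c ` {1..k}" and supp: "\<And>i. i \<in> {1..k} \<Longrightarrow> strong_support W (c i)"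
  shows "star_partition \<Delta> W (Suc k) (V(Suc k := insert v L)) (c(Suc k := v))"
proof -
  note P = pendant_star_simps
  note Q = P'[unfolded star_partition_def]
  have L_pend: "pendant W l" "E v l" if "l \<in> L" for l
    using P(6)[OF that] P(4,7) that nb_iff[of l W v] by (auto simp: pendant_def)
  obtain l l' where l: "l \<in> L" "l' \<in> L" "l \<noteq> l'"
    using L2 two_distinct_elements by metis
  have Suc_k: "{1..Suc k} = insert (Suc k) {1..k}" "{2..Suc k} = insert (Suc k) {2..k}"
    using Q by auto
  have old: "i \<noteq> Suc k" if "i \<in> {1..k}" for i using that by simp
  have old2: "i \<noteq> Suc k" if "i \<in> {2..k}" for i using that by simp
  have cW: "c i \<in> W'" if "i \<in> {1..k}" for i using Q that by (simp add: strong_support_def)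
  have Vc: "V i \<inter> insert v L = {}" if "i \<in> {1..k}" for i using Q that P(15) by blast
  have "star (\<Delta> - 1) v (insert v L)"
  proof -
    have "E x y \<longleftrightarrow> x \<noteq> y \<and> (x = v \<or> y = v)" if "x \<in> insert v L" "y \<in> insert v L" for x y
    proof (cases "x = v")
      case True
      then show ?thesis using that L_pend(2) E_irrefl by auto
    next
      case False
      then have "y \<in> nb W x \<longleftrightarrow> y = v" using P(6) that by simp
      moreover have "y \<in> W" using that P(2,7) by auto
      ultimately show ?thesis using False by (auto simp: nb_iff)
    qed
    then show ?thesis using L2 P(8,9) by (auto simp: star_def)
  qed
  moreover have "strong_support W v"
    using l L_pend P(2) unfolding strong_support_def by blast
  moreover have "card (nb W v) = \<Delta>" using P(4,5,8) L2 by simp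
  moreover have "nb W (c i) = nb W' (c i)" if "i \<in> {1..k}" for i
    using pendant_star_nb_v[OF cW[OF that]] u that by blast
  moreover have nE: "\<not> E v (c i)" if "i \<in> {1..k}" for i
  proof
    assume "E v (c i)"
    then have "c i \<in> insert u L" using cW[OF that] P(4,12) nb_iff[of "c i" W v] by blast
    then show False using cW[OF that] P(15) u that by blast
  qed
  moreover have "\<not> E (c i) v" if "i \<in> {1..k}" for i using nE[OF that] E_commute[of v] by simp
  moreover have "(\<Union>i\<in>{1..Suc k}. (V(Suc k := insert v L)) i) = W"
    using Q P(14) old unfolding Suc_k by auto
  moreover have "disjoint_family_on (V(Suc k := insert v L)) {1..Suc k}"
    using Q Vc old unfolding Suc_k disjoint_family_on_def by (auto simp: Int_commute)
  ultimately show ?thesis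
    unfolding star_partition_def Suc_k using Q supp old old2 E_irrefl by auto
qed

end

section \<open>Finding a pendant star, and the induction\<close>

lemma nb_eq_singleton: "finite W \<Longrightarrow> card (nb W x) \<le> 1 \<Longrightarrow> y \<in> nb W x \<Longrightarrow> nb W x = {y}"
  using card_le_Suc0_iff_eq[of "nb W x"] by auto

text \<open>Acyclicity, applied to the set \<open>W0\<close> of vertices of degree at least 2,
  yields \<open>v\<close> with at most one neighbor in \<open>W0\<close>; its other neighbors are
  leaves.\<close>

lemma pendant_star_exists:
  assumes ac: "acyclic_on W" and conn: "connected_on W" and "W \<noteq> {}"
    and not_star: "\<And>c. c \<in> W \<Longrightarrow> \<not> W \<subseteq> insert c (nb W c)"
  shows "\<exists>u v L. pendant_star W u v L \<and> L \<noteq> {} \<and> 2 \<le> card (nb W u)"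
proof -
  note fin = acyclic_on_finite[OF ac]
  define W0 where "W0 = {x \<in> W. 2 \<le> card (nb W x)}"
  \<comment> \<open>Otherwise \<open>x\<close> and its neighbors form a set closed under adjacency,
    so \<open>W\<close> would be a star around \<open>x\<close>.\<close>
  have ex: "nb W0 x \<noteq> {}" if x: "x \<in> W" for x
  proof
    assume no: "nb W0 x = {}"
    have "insert x (nb W x) = W"
    proof (rule connected_onD[OF conn])
      fix a y assume ay: "a \<in> insert x (nb W x)" "y \<in> W" "E a y"
      show "y \<in> insert x (nb W x)"
      proof (cases "a = x")
        case True
        then show ?thesis using ay by (simp add: nb_iff)
      next
        case False
        then have a: "a \<in> nb W x" using ay by simp
        then have "a \<notin> W0" using no by (auto simp: nb_iff)
        then have "card (nb W a) \<le> 1" using a by (simp add: W0_def nb_iff)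
        then have "nb W a = {x}" using nb_eq_singleton[OF fin] nb_sym[OF a x] by blast
        moreover have "y \<in> nb W a" using ay by (simp add: nb_iff)
        ultimately show ?thesis by simp
      qed
    qed (use x in \<open>auto simp: nb_iff\<close>)
    then show False using not_star[OF x] by blast
  qed
  have "W0 \<noteq> {}" using ex \<open>W \<noteq> {}\<close> by (auto simp: nb_def)
  moreover have W0: "W0 \<subseteq> W" by (auto simp: W0_def)
  ultimately obtain v where v: "v \<in> W0" "card (nb W0 v) \<le> 1"
    using ac unfolding acyclic_on_def by blast
  then have vW: "v \<in> W" "2 \<le> card (nb W v)" by (auto simp: W0_def)
  obtain u where u: "u \<in> nb W0 v" using ex[OF vW(1)] by blast
  have nbv: "nb W0 v = {u}" using nb_eq_singleton[OF _ v(2) u] fin W0 finite_subset by blast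
  have uW: "u \<in> W" "2 \<le> card (nb W u)" "u \<in> nb W v" using u by (auto simp: nb_iff W0_def)
  let ?L = "nb W v - {u}"
  have "nb W l = {v}" if l: "l \<in> ?L" for l
  proof -
    have lW: "l \<in> nb W v" "l \<notin> W0" using l nbv nb_iff[of l W0 v] nb_iff[of l W v] by auto
    then have "card (nb W l) \<le> 1" by (simp add: W0_def nb_iff)
    then show ?thesis using nb_eq_singleton[OF fin] nb_sym[OF lW(1) vW(1)] by blast
  qed
  then have "pendant_star W u v ?L"
    using fin vW uW unfolding pendant_star_def by auto
  moreover have "?L \<noteq> {}"
  proof
    assume "?L = {}"
    then have "nb W v \<subseteq> {u}" by blast
    then have "card (nb W v) \<le> card {u}" by (rule card_mono[rotated]) simp
    then show False using vW by simp
  qed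
  ultimately show ?thesis using uW by blast
qed

lemma star_partition_star:
  assumes "star \<Delta> c W"
  shows "star_partition \<Delta> W 1 (\<lambda>_. W) (\<lambda>_. c)"
proof -
  have c: "c \<in> W" and E: "\<And>x y. x \<in> W \<Longrightarrow> y \<in> W \<Longrightarrow> E x y \<longleftrightarrow> x \<noteq> y \<and> (x = c \<or> y = c)"
    and card: "card (W - {c}) = \<Delta>" "2 \<le> \<Delta>"
    using assms by (auto simp: star_def)
  have nbc: "nb W c = W - {c}" using c E by (auto simp: nb_iff)
  have nbl: "pendant W l" if "l \<in> W - {c}" for l
  proof -
    have "nb W l = {c}" using that c E by (auto simp: nb_iff)
    then show ?thesis using that by (simp add: pendant_def)
  qed
  obtain l l' where "l \<in> W - {c}" "l' \<in> W - {c}" "l \<noteq> l'"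
    using card two_distinct_elements by metis
  then have "strong_support W c" using nbl nbc c unfolding strong_support_def by (metis nb_iff)
  then show ?thesis
    using assms nbc card E_irrefl by (simp add: star_partition_def disjoint_family_on_def)
qed

text \<open>An edge between two vertices other than \<open>c\<close> would close a triangle, in
  which every degree is 2.\<close>

lemma acyclic_on_star:
  assumes ac: "acyclic_on W" and c: "c \<in> W" "W \<subseteq> insert c (nb W c)" and W3: "3 \<le> card W"
  shows "star (card W - 1) c W"
proof -
  have E1: "E c x" if "x \<in> W" "x \<noteq> c" for x using that c by (auto simp: nb_iff)
  have "\<not> E x y" if xy: "x \<in> W" "y \<in> W" "x \<noteq> c" "y \<noteq> c" for x y
  proof
    assume "E x y"
    let ?U = "{c, x, y}"
    have ne: "x \<noteq> y" using \<open>E x y\<close> E_irrefl by blast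
    have "E y x" "E c x" "E x c" "E c y" "E y c" using E1 xy \<open>E x y\<close> by (blast intro: E_sym)+
    then have sup: "{x, y} \<subseteq> nb ?U c" "{c, y} \<subseteq> nb ?U x" "{c, x} \<subseteq> nb ?U y"
      using \<open>E x y\<close> by (simp_all add: nb_iff)
    have "card (nb ?U a) \<ge> 2" if "a \<in> ?U" for a
    proof -
      have two: "card (nb ?U a) \<ge> 2" if "{p, q} \<subseteq> nb ?U a" "p \<noteq> q" for p q
        using card_mono[OF _ that(1)] that(2) by simp
      consider "a = c" | "a = x" | "a = y" using \<open>a \<in> ?U\<close> by blast
      then show ?thesis
      proof cases
        case 1
        then show ?thesis using two sup(1) ne by blast
      next
        case 2
        then show ?thesis using two sup(2) xy(4) by blast
      next
        case 3
        then show ?thesis using two sup(3) xy(3) by blast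
      qed
    qed
    moreover obtain a where "a \<in> ?U" "card (nb ?U a) \<le> 1"
      using ac xy c(1) unfolding acyclic_on_def by (metis empty_subsetI insert_not_empty insert_subset)
    ultimately show False by force
  qed
  then show ?thesis
    using c W3 acyclic_on_finite[OF ac] E1 E_commute[of _ c] E_irrefl by (auto simp: star_def)
qed

text \<open>Here \<open>\<Delta>\<close> is only an upper bound on the degrees, so it passes to
  subtrees. The second alternative carries the partition along, to trace equality through the
  induction.\<close>

lemma total_forcing_exists:
  assumes "acyclic_on W" "connected_on W" "3 \<le> card W" "\<And>x. x \<in> W \<Longrightarrow> card (nb W x) \<le> \<Delta>"
  shows "\<exists>S. total_forcing W S \<and> (card W \<le> \<Delta> * card (W - S) \<or>
           card W = Suc (\<Delta> * card (W - S)) \<and> (\<exists>k V c. star_partition \<Delta> W k V c))"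
  using assms
proof (induction "card W" arbitrary: W rule: less_induct)
  case less
  note ac = less.prems(1) and conn = less.prems(2) and W3 = less.prems(3) and deg = less.prems(4)
  note fin = acyclic_on_finite[OF ac]
  have deg': "card (nb U x) \<le> \<Delta>" if "U \<subseteq> W" "x \<in> U" for U x
  proof -
    have "card (nb U x) \<le> card (nb W x)" using that fin by (intro card_mono) (auto simp: nb_iff)
    then show ?thesis using deg[of x] that by (meson order_trans subsetD)
  qed
  show ?case
  proof (cases "\<exists>c\<in>W. W \<subseteq> insert c (nb W c)")
    case True
    then obtain c where c: "c \<in> W" "W \<subseteq> insert c (nb W c)" by blast
    let ?m = "card W - 1"
    have st: "star ?m c W" using acyclic_on_star[OF ac c W3] .
    have "nb W c = W - {c}" using c E_irrefl by (auto simp: nb_iff)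
    then have "?m \<le> \<Delta>" using deg[OF c(1)] c fin by simp
    moreover obtain S where "total_forcing W S" "card (W - S) = 1"
      using star_total_forcing[OF st] by blast
    moreover have "\<exists>k V c. star_partition \<Delta> W k V c" if "?m = \<Delta>"
      using star_partition_star st that by blast
    ultimately show ?thesis using W3 by (intro exI[of _ S]) auto
  next
    case False
    then have not_star: "\<And>c. c \<in> W \<Longrightarrow> \<not> W \<subseteq> insert c (nb W c)" by blast
    show ?thesis
    proof (cases "\<exists>z v u. z \<in> W \<and> nb W z = {v} \<and> nb W v = {u, z} \<and> u \<noteq> z")
      case True
      then obtain z v u where z: "z \<in> W" "nb W z = {v}" and v: "nb W v = {u, z}" "u \<noteq> z" by blast
      let ?W = "W - {z}"
      have vW: "v \<in> W" "u \<in> W" "v \<noteq> z" "u \<noteq> v"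
        using z v nb_iff[of v W z] nb_iff[of u W v] E_irrefl by auto
      have D2: "2 \<le> \<Delta>" using deg[OF vW(1)] v by simp
      \<comment> \<open>The path on these three vertices would be a star around \<open>v\<close>;
        hence \<open>?W\<close> still has order at least 3.\<close>
      have "\<not> W \<subseteq> {v, u, z}" using not_star[OF vW(1)] v by simp
      moreover have "{v, u, z} \<subseteq> W" "card {v, u, z} = 3" using vW z v by auto
      ultimately have "3 < card W" using fin psubset_card_mono[of W "{v, u, z}"] by auto
      then have cW: "card W = Suc (card ?W)" "3 \<le> card ?W" using z fin by simp_all
      have conn': "connected_on ?W"
      proof (rule connected_on_Diff[OF conn, of _ "{z}" v])
        fix x y assume "x \<in> ?W" "y \<in> {z}" "E x y"
        then have "x \<in> nb W z" using E_sym by (auto simp: nb_iff)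
        then show "x = v" using z by simp
      qed (use z vW in auto)
      obtain S where S: "total_forcing ?W S" and le: "card ?W \<le> Suc (\<Delta> * card (?W - S))"
        using less.hyps[of ?W] cW conn' acyclic_on_subset[OF ac] deg'[of ?W] by auto
      have SW: "S \<subseteq> ?W" using S by (simp add: total_forcing_def forcing_def)
      have "W - S = insert z (?W - S)" using SW z by blast
      then have "card (W - S) = Suc (card (?W - S))" using fin by simp
      \<comment> \<open>The order grows by 1 and the right-hand side by
        \<open>\<Delta> \<ge> 2\<close>, so the first alternative always results.\<close>
      then have "card W \<le> \<Delta> * card (W - S)" using le cW(1) D2 by simp
      then show ?thesis using total_forcing_insert_pendant[OF fin z v S] by blast
    next
      case no_path: False
      have "W \<noteq> {}" using W3 by auto
      then obtain u v L where ps: "pendant_star W u v L" and L: "L \<noteq> {}" and du: "2 \<le> card (nb W u)"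
        using pendant_star_exists[OF ac conn _ not_star] by blast
      define W' where "W' = W - insert v L"
      note P = pendant_star_simps[OF ps W'_def]
      note nbu = pendant_star_nb_u[OF ps W'_def] and nbv = pendant_star_nb_v[OF ps W'_def]
      have L2: "2 \<le> card L"
      proof (rule ccontr)
        assume "\<not> 2 \<le> card L"
        then have "card L = 1" using L P(8) card_0_eq[of L] by linarith
        then obtain z where "L = {z}" by (rule card_1_singletonE)
        then have "z \<in> W" "nb W z = {v}" "nb W v = {u, z}" "u \<noteq> z" using P(4,5,6,7) by auto
        then show False using no_path by blast
      qed
      have W'3: "3 \<le> card W'"
      proof -
        have "nb W' u \<noteq> {}" using du nbu by auto
        then obtain w where w: "w \<in> nb W' u" by blast
        have wW: "w \<in> W'" "w \<noteq> u" using w E_irrefl by (auto simp: nb_iff)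
        \<comment> \<open>Otherwise \<open>w\<close> would be a leaf of \<open>W\<close> whose
          neighbor \<open>u\<close> has degree 2, the case already treated.\<close>
        have "W' \<noteq> {u, w}"
        proof
          assume eq: "W' = {u, w}"
          have "nb W' u = {w}" using w eq E_irrefl by (auto simp: nb_iff)
          moreover have "nb W' w = {u}" using nb_sym[OF w P(11)] eq E_irrefl by (auto simp: nb_iff)
          ultimately have "nb W w = {u}" "nb W u = {v, w}" using nbu nbv[OF wW] by simp_all
          moreover have "w \<in> W" "v \<noteq> w" using wW P(12,15) by auto
          ultimately show False using no_path by blast
        qed
        then have "{u, w} \<subset> W'" using wW P(11) by blast
        then have "card {u, w} < card W'" by (rule psubset_card_mono[OF P(13)])
        then show ?thesis using wW(2) by simp
      qed
      have dv: "Suc (card L) \<le> \<Delta>" using deg[OF P(2)] P(4,5,8) by simp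
      obtain S where S: "total_forcing W' S" and alt: "card W' \<le> \<Delta> * card (W' - S) \<or>
           card W' = Suc (\<Delta> * card (W' - S)) \<and> (\<exists>k V c. star_partition \<Delta> W' k V c)"
      proof -
        have "card W' < card W" using P(16) by simp
        then show ?thesis
          using that less.hyps[of W', OF _ acyclic_on_subset[OF ac P(12)]
              pendant_star_connected_on[OF ps W'_def conn] W'3 deg'[OF P(12)]] by blast
      qed
      obtain S' where S': "total_forcing W S'" "card (W - S') = Suc (card (W' - S))"
        using pendant_star_total_forcing[OF ps W'_def L2 S] by blast
      show ?thesis
      proof (cases "card W \<le> \<Delta> * card (W - S')")
        case True
        then show ?thesis using S' by blast
      next
        case not_le: False
        \<comment> \<open>At most \<open>\<Delta>\<close> vertices were deleted while the right-hand
          side grew by \<open>\<Delta>\<close>, so failure leaves no slack in either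
          inequality.\<close>
        then have eq: "card W' = Suc (\<Delta> * card (W' - S))" "Suc (card L) = \<Delta>"
          using alt S'(2) P(16) dv by auto
        then obtain k V c where part: "star_partition \<Delta> W' k V c" using alt by auto
        define C where "C = c ` {1..k}"
        have C: "center_set \<Delta> W' C" using star_partition_center_set[OF part] by (simp add: C_def)
        \<comment> \<open>A center has degree \<open>\<Delta>\<close> already in \<open>W'\<close>;
          the edge to \<open>v\<close> would exceed the bound.\<close>
        have uC: "u \<notin> C"
        proof
          assume "u \<in> C"
          then have "card (nb W' u) = \<Delta>" using C by (simp add: center_set_def)
          moreover have "v \<notin> nb W' u" using P(15) by (auto simp: nb_iff)
          ultimately show False using nbu deg[OF P(3)] P(13) by simp
        qed
        show ?thesis
        proof (cases "\<forall>w\<in>C. strong_support W w")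
          case True
          then have "star_partition \<Delta> W (Suc k) (V(Suc k := insert v L)) (c(Suc k := v))"
            using uC by (intro pendant_star_star_partition[OF ps W'_def part L2 eq(2)]) (auto simp: C_def)
          moreover have "card W = Suc (\<Delta> * card (W - S'))" using eq S'(2) P(16) by simp
          ultimately show ?thesis using S' by blast
        next
          case False
          then obtain w where "w \<in> C" "\<not> strong_support W w" by blast
          then obtain R where R: "total_forcing W R" "card (W - R) = card C + 2"
            using pendant_star_lost_support[OF ps W'_def ac conn L2 C uC] by blast
          have "card W' = Suc (\<Delta> * card C)" using C by (simp add: center_set_def)
          \<comment> \<open>Here \<open>card W = Suc (\<Delta> * card C) + \<Delta>\<close>, which
            is at most \<open>\<Delta> * (card C + 2)\<close>.\<close>
          then have "card W \<le> \<Delta> * card (W - R)" using R(2) P(16) eq(2) L2 by (simp add: algebra_simps)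
          then show ?thesis using R by blast
        qed
      qed
    qed
  qed
qed

end

section \<open>Transfer to digraphs\<close>

lemma (in graph) dominates_adjacency: "adjacency (\<lambda>u v. u \<rightarrow>\<^bsub>G\<^esub> v)"
  using arcs_ends_symmetric[OF sym_arcs] adj_not_same by unfold_locales blast+

sublocale graph \<subseteq> adj: adjacency "\<lambda>u v. u \<rightarrow>\<^bsub>G\<^esub> v"
  by (rule dominates_adjacency)

lemma dominates_induce_subgraph:
  "u \<rightarrow>\<^bsub>G \<restriction> S\<^esub> v \<longleftrightarrow> u \<rightarrow>\<^bsub>G\<^esub> v \<and> u \<in> S \<and> v \<in> S"
  by (auto simp: arcs_ends_conv image_iff)

context graph
begin

lemma nb_verts: "adj.nb (verts G) x = {y. x \<rightarrow>\<^bsub>G\<^esub> y}"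
  using adj_in_verts by (auto simp: adj.nb_iff)

text \<open>Without parallel arcs, \<open>head G\<close> is injective on the arcs leaving
  \<open>x\<close>.\<close>

lemma out_degree_eq_card_nb: "out_degree G x = card (adj.nb (verts G) x)"
proof -
  have "inj_on (head G) (out_arcs G x)"
    by (rule inj_onI) (auto intro!: no_multi_arcs simp: arc_to_ends_def)
  moreover have "head G ` out_arcs G x = adj.nb (verts G) x"
    unfolding nb_verts by (auto simp: arcs_ends_conv image_iff)
  ultimately show ?thesis
    unfolding out_degree_def by (metis card_image)
qed

lemma leaf_iff_pendant: "leaf G x \<longleftrightarrow> adj.pendant (verts G) x"
  by (simp add: leaf_def adj.pendant_def out_degree_eq_card_nb)

lemma strong_support_vertex_iff: "strong_support_vertex G x \<longleftrightarrow> adj.strong_support (verts G) x"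
  by (simp add: strong_support_vertex_def adj.strong_support_def leaf_iff_pendant)

lemma force_step_eq_step: "force_step G = adj.step (verts G)"
proof (intro ext)
  fix A B
  have "adj.nb (verts G) x - A = {w. x \<rightarrow>\<^bsub>G\<^esub> w \<and> w \<notin> A}" for x
    by (auto simp: nb_verts)
  then show "force_step G A B = adj.step (verts G) A B"
    by (auto simp: force_step.simps adj.step_def)
qed

lemma forcing_set_iff: "forcing_set G S \<longleftrightarrow> adj.forcing (verts G) S"
  by (simp add: forcing_set_def adj.forcing_def force_step_eq_step)

lemma graph_induce_subgraph:
  assumes "S \<subseteq> verts G"
  shows "graph (G \<restriction> S)"
proof -
  have ind: "induced_subgraph (G \<restriction> S) G" using assms by (rule induced_induce)
  then interpret H: digraph "G \<restriction> S" by (rule digraphI_induced)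
  have "symmetric (G \<restriction> S)" using sym_arcs ind by (rule induced_graph_imp_symmetric)
  then show ?thesis by (rule H.graphI)
qed

lemma out_degree_induce_subgraph:
  assumes "S \<subseteq> verts G" "x \<in> S"
  shows "out_degree (G \<restriction> S) x = card (adj.nb S x)"
proof -
  interpret H: graph "G \<restriction> S" using graph_induce_subgraph[OF assms(1)] .
  have "y \<in> H.adj.nb (verts (G \<restriction> S)) x \<longleftrightarrow> y \<in> adj.nb S x" for y
    using assms(2) dominates_induce_subgraph[of x y G S] unfolding H.adj.nb_iff adj.nb_iff by auto
  then have "H.adj.nb (verts (G \<restriction> S)) x = adj.nb S x" by blast
  then show ?thesis by (simp only: H.out_degree_eq_card_nb)
qed

lemma total_forcing_set_iff: "total_forcing_set G S \<longleftrightarrow> adj.total_forcing (verts G) S"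
proof (cases "S \<subseteq> verts G")
  case True
  have "isolated_vertex (G \<restriction> S) v \<longleftrightarrow> v \<in> S \<and> \<not> (\<exists>y\<in>S. v \<rightarrow>\<^bsub>G\<^esub> y)" for v
  proof (cases "v \<in> S")
    case vS: True
    have "finite (adj.nb S v)" using True finite_subset[OF _ finite_verts] by simp
    then show ?thesis
      using out_degree_induce_subgraph[OF True vS] vS
      by (auto simp: isolated_vertex_def adj.nb_def)
  qed (simp add: isolated_vertex_def)
  then show ?thesis
    by (auto simp: total_forcing_set_def adj.total_forcing_def adj.no_isolated_def forcing_set_iff)
next
  case False
  then show ?thesis
    by (simp add: total_forcing_set_def forcing_set_def adj.total_forcing_def adj.forcing_def)
qed

text \<open>Being no leaf singles out \<open>c\<close> as the center and rules out
  \<open>m = 1\<close>, where both vertices are leaves. The case \<open>m = 0\<close> must be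
  excluded by hypothesis, as a lone vertex is no leaf.\<close>

lemma induced_star_iff:
  assumes X: "X \<subseteq> verts G" and m: "m \<ge> 1"
  shows "K\<^bsub>1,m\<^esub> (G \<restriction> X) \<and> c \<in> X \<and> \<not> leaf (G \<restriction> X) c \<longleftrightarrow> adj.star m c X"
proof
  assume asm: "K\<^bsub>1,m\<^esub> (G \<restriction> X) \<and> c \<in> X \<and> \<not> leaf (G \<restriction> X) c"
  then obtain U V where UV: "X = U \<union> V" "U \<inter> V = {}" "card U = 1" "card V = m"
      "arcs_ends (G \<restriction> X) = U \<times> V \<union> V \<times> U"
    by (auto simp: complete_bipartite_digraph_def)
  obtain a where a: "U = {a}" using UV(3) by (rule card_1_singletonE)
  have fin: "finite X" using X finite_verts finite_subset by blast
  have E: "x \<rightarrow>\<^bsub>G\<^esub> y \<longleftrightarrow> x = a \<and> y \<in> V \<or> x \<in> V \<and> y = a" if "x \<in> X" "y \<in> X" for x y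
    using dominates_induce_subgraph[of x y G X] that unfolding UV(5) a by auto
  have deg: "card (adj.nb X c) \<noteq> 1"
    using asm out_degree_induce_subgraph[OF X, of c] by (simp add: leaf_def)
  have aV: "a \<notin> V" using UV(2) a by simp
  have X_eq: "X = insert a V" using UV(1) a by simp
  have "c = a"
  proof (rule ccontr)
    assume "c \<noteq> a"
    then have "c \<in> V" using asm X_eq by simp
    then have "y \<in> adj.nb X c \<longleftrightarrow> y = a" for y
      using E[of c y] aV X_eq by (auto simp: adj.nb_iff)
    then have "adj.nb X c = {a}" by blast
    then show False using deg by simp
  qed
  moreover have "y \<in> adj.nb X a \<longleftrightarrow> y \<in> V" for y
    using E[of a y] aV X_eq by (auto simp: adj.nb_iff)
  then have "adj.nb X a = V" by blast
  ultimately have "2 \<le> m" using deg UV(4) m by simp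
  moreover have "card X = Suc m" using X_eq aV UV(4) fin by simp
  moreover have "x \<rightarrow>\<^bsub>G\<^esub> y \<longleftrightarrow> x \<noteq> y \<and> (x = c \<or> y = c)" if "x \<in> X" "y \<in> X" for x y
    using E[OF that] that aV X_eq \<open>c = a\<close> by auto
  ultimately show "adj.star m c X"
    using asm fin by (simp add: adj.star_def)
next
  assume st: "adj.star m c X"
  then have c: "c \<in> X" and fin: "finite X" and m: "card (X - {c}) = m" "2 \<le> m"
    and E: "\<And>x y. x \<in> X \<Longrightarrow> y \<in> X \<Longrightarrow> x \<rightarrow>\<^bsub>G\<^esub> y \<longleftrightarrow> x \<noteq> y \<and> (x = c \<or> y = c)"
    by (auto simp: adj.star_def)
  have "p \<in> arcs_ends (G \<restriction> X) \<longleftrightarrow> p \<in> {c} \<times> (X - {c}) \<union> (X - {c}) \<times> {c}" for p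
    using dominates_induce_subgraph[of "fst p" "snd p" G X] E[of "fst p" "snd p"] c
    by (cases p) auto
  then have "arcs_ends (G \<restriction> X) = {c} \<times> (X - {c}) \<union> (X - {c}) \<times> {c}" by blast
  moreover have "X = {c} \<union> (X - {c})" "{c} \<inter> (X - {c}) = {}" "card {c} = 1" using c by auto
  ultimately have "K\<^bsub>1,m\<^esub> (G \<restriction> X)"
    unfolding complete_bipartite_digraph_def induce_subgraph_verts
    using graph_induce_subgraph[OF X] m(1) by blast
  moreover have "y \<in> adj.nb X c \<longleftrightarrow> y \<in> X - {c}" for y
    using E[OF c, of y] by (auto simp: adj.nb_iff)
  then have "adj.nb X c = X - {c}" by blast
  then have "\<not> leaf (G \<restriction> X) c"
    using m out_degree_induce_subgraph[OF X c] by (simp add: leaf_def)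
  ultimately show "K\<^bsub>1,m\<^esub> (G \<restriction> X) \<and> c \<in> X \<and> \<not> leaf (G \<restriction> X) c"
    using c by simp
qed

section \<open>Connectedness and acyclicity of undirected trees in relational form\<close>

lemma connected_imp_connected_on:
  assumes "connected G"
  shows "adj.connected_on (verts G)"
  unfolding adj.connected_on_def
proof (intro allI impI)
  fix A assume A: "A \<subseteq> verts G" "A \<noteq> {}" "\<forall>x\<in>A. adj.nb (verts G) x \<subseteq> A"
  obtain a where a: "a \<in> A" using A by blast
  have sc: "strongly_connected G"
    using assms by (rule symmetric_connected_imp_strongly_connected[OF sym_arcs])
  have "y \<in> A" if "y \<in> verts G" for y
  proof -
    have "a \<rightarrow>\<^sup>* y" using sc a A(1) that by (auto simp: strongly_connected_def)
    then show ?thesis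
      by (induction rule: reachable_induct) (use a A(3) in \<open>auto simp: nb_verts\<close>)
  qed
  then show "A = verts G" using A(1) by blast
qed

text \<open>
  A longest path inside \<open>U\<close> starts at a vertex all of whose neighbors in \<open>U\<close> lie on the path.
  Two neighbors would close a cycle, since only one of them can be the second vertex of the path.
\<close>
lemma no_cycle_imp_acyclic_on:
  assumes nocyc: "\<And>p. cycle p \<Longrightarrow> length p < 3"
  shows "adj.acyclic_on (verts G)"
  unfolding adj.acyclic_on_def
proof (intro conjI allI impI)
  fix U assume U: "U \<subseteq> verts G" "U \<noteq> {}"
  let ?P = "\<lambda>(u, p, w). apath u p w \<and> set (awalk_verts u p) \<subseteq> U"
  let ?len = "\<lambda>(u, p, w). length p"
  obtain x where "x \<in> U" using U by blast
  then have P: "?P (x, [], x)" using U by (auto simp: apath_Nil_iff)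
  have bound: "\<forall>t. ?P t \<longrightarrow> ?len t < card (verts G)"
  proof (intro allI impI)
    fix t assume "?P t"
    moreover obtain u p w where "t = (u, p, w)" by (cases t)
    ultimately show "?len t < card (verts G)" using length_apath_less[of u p w] by simp
  qed
  obtain t where t: "?P t" "\<And>s. ?P s \<Longrightarrow> ?len s \<le> ?len t"
    using ex_has_greatest_nat[of ?P, OF P bound] by blast
  obtain u p w where tt: "t = (u, p, w)" by (cases t)
  then have p: "apath u p w" "set (awalk_verts u p) \<subseteq> U" using t(1) by auto
  have max: "length p' \<le> length p" if "apath u' p' w'" "set (awalk_verts u' p') \<subseteq> U" for u' p' w'
    using t(2)[of "(u', p', w')"] that tt by simp
  have aw: "awalk u p w" and dist: "distinct (awalk_verts u p)" using p by (auto simp: apath_def)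
  have uU: "u \<in> U" using hd_in_awalk_verts(1)[OF aw] p(2) by blast
  have second: "length p > 0 \<and> y = head G (hd p)" if y: "y \<in> adj.nb U u" for y
  proof -
    have yU: "y \<in> U" "u \<rightarrow>\<^bsub>G\<^esub> y" using y by (auto simp: adj.nb_iff)
    then have "y \<rightarrow>\<^bsub>G\<^esub> u" using adj.E_commute[of u y] by simp
    then obtain e where e: "e \<in> arcs G" "tail G e = y" "head G e = u" by (rule reachableE)
    have "y \<in> set (awalk_verts u p)"
    proof (rule ccontr)
      assume "y \<notin> set (awalk_verts u p)"
      then have "apath y (e # p) w" using p(1) e by (simp add: apath_Cons_iff)
      moreover have "set (awalk_verts y (e # p)) \<subseteq> U" using p(2) e yU by simp
      ultimately show False using max by fastforce
    qed
    then obtain q r where qr: "p = q @ r" "awalk u q y" using awalk_decomp[OF aw] by blast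
    have "apath u q (awlast u q)" using p(1) unfolding qr(1) apath_append_iff by simp
    then have dq: "distinct (awalk_verts u q)" by (simp add: apath_def)
    \<comment> \<open>The segment \<open>q\<close> from \<open>u\<close> to \<open>y\<close> closes
      up through \<open>e\<close>. Cycles have fewer than 3 arcs and \<open>y\<close> differs from
      \<open>u\<close>, so \<open>q\<close> is a single arc, the first of \<open>p\<close>.\<close>
    have "awalk y (e # q) y" using qr(2) e by (simp add: awalk_Cons_iff)
    then have "cycle (e # q)" using dq e unfolding cycle_def by (intro exI[of _ y]) simp
    then have "length q < 2" using nocyc by fastforce
    moreover have "q \<noteq> []" using qr(2) yU adj_not_same by (auto simp: awalk_Nil_iff)
    ultimately obtain f where "q = [f]" by (cases q) auto
    then show ?thesis using qr by (auto simp: awalk_Cons_iff awalk_Nil_iff)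
  qed
  then have "adj.nb U u \<subseteq> {head G (hd p)}" by blast
  then have "card (adj.nb U u) \<le> 1" using card_mono[of "{head G (hd p)}"] by simp
  then show "\<exists>x\<in>U. card (adj.nb U x) \<le> 1" using uU by blast
qed simp

end

text \<open>With \<open>2 \<le> \<Delta>\<close>, both star sizes \<open>\<Delta>\<close> and
  \<open>\<Delta> - 1\<close> are at least 1, as \<open>induced_star_iff\<close> requires.\<close>

lemma tree_family_iff:
  assumes tree: "undirected_tree T" and \<Delta>: "max_degree T = \<Delta>" "2 \<le> \<Delta>"
  shows "T \<in> tree_family \<Delta> \<longleftrightarrow>
    (\<exists>k V c. adjacency.star_partition (\<lambda>u v. u \<rightarrow>\<^bsub>T\<^esub> v) \<Delta> (verts T) k V c)"
proof -
  interpret graph T using tree by (simp add: undirected_tree_def)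
  define P where "P k V c \<longleftrightarrow>
       (k \<ge> 1 \<and>
        (\<Union>i\<in>{1..k}. V i) = verts T \<and> disjoint_family_on V {1..k} \<and>
        K\<^bsub>1,\<Delta>\<^esub> (T \<restriction> V 1) \<and>
        (\<forall>i\<in>{2..k}. K\<^bsub>1,\<Delta> - 1\<^esub> (T \<restriction> V i)) \<and>
        (\<forall>i\<in>{1..k}. c i \<in> V i \<and> \<not> leaf (T \<restriction> V i) (c i)) \<and>
        (\<forall>i\<in>{1..k}. strong_support_vertex T (c i) \<and> out_degree T (c i) = \<Delta>) \<and>
        (\<forall>i\<in>{1..k}. \<forall>j\<in>{1..k}. \<not> c i \<rightarrow>\<^bsub>T\<^esub> c j))" for k :: nat and V c
  have iff: "P k V c \<longleftrightarrow> adj.star_partition \<Delta> (verts T) k V c" for k V c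
  proof (cases "k \<ge> 1 \<and> (\<Union>i\<in>{1..k}. V i) = verts T")
    case True
    then have k: "{1..k} = insert 1 {2..k}" and V: "\<And>i. i \<in> {1..k} \<Longrightarrow> V i \<subseteq> verts T" by auto
    have "adj.star \<Delta> (c 1) (V 1) \<longleftrightarrow> K\<^bsub>1,\<Delta>\<^esub> (T \<restriction> V 1) \<and> c 1 \<in> V 1 \<and> \<not> leaf (T \<restriction> V 1) (c 1)"
      using induced_star_iff[of "V 1" \<Delta> "c 1"] V[of 1] True \<Delta> by simp
    moreover have "adj.star (\<Delta> - 1) (c i) (V i) \<longleftrightarrow>
        K\<^bsub>1,\<Delta> - 1\<^esub> (T \<restriction> V i) \<and> c i \<in> V i \<and> \<not> leaf (T \<restriction> V i) (c i)" if "i \<in> {2..k}" for i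
      using induced_star_iff[of "V i" "\<Delta> - 1" "c i"] V[of i] that \<Delta> by simp
    ultimately show ?thesis
      unfolding P_def adj.star_partition_def strong_support_vertex_iff out_degree_eq_card_nb
      using k by auto
  qed (auto simp: P_def adj.star_partition_def)
  have "T \<in> tree_family \<Delta> \<longleftrightarrow> (\<exists>k V c. P k V c)"
    unfolding tree_family_def mem_Collect_eq P_def using tree \<Delta>(1) by (simp only: simp_thms)
  then show ?thesis by (simp only: iff)
qed

theorem theorem3:
  fixes T :: "('a, 'b) pre_digraph" and n \<Delta> :: nat
  assumes "undirected_tree T"
    and "card (verts T) = n" and "n \<ge> 3"
    and "max_degree T = \<Delta>"
  shows "real (total_forcing_number T) \<le> ((real \<Delta> - 1) * real n + 1) / real \<Delta> \<and>
         (real (total_forcing_number T) = ((real \<Delta> - 1) * real n + 1) / real \<Delta>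
            \<longleftrightarrow> T \<in> tree_family \<Delta>)"
proof -
  interpret graph T using assms(1) by (simp add: undirected_tree_def)
  let ?W = "verts T"
  have conn: "adj.connected_on ?W"
    using assms(1) connected_imp_connected_on by (simp add: undirected_tree_def)
  have ac: "adj.acyclic_on ?W"
    using assms(1) by (intro no_cycle_imp_acyclic_on) (auto simp: undirected_tree_def not_le)
  have deg: "card (adj.nb ?W x) \<le> \<Delta>" if "x \<in> ?W" for x
    using that assms(4) Max_ge[of "out_degree T ` ?W" "out_degree T x"]
    by (simp add: max_degree_def out_degree_eq_card_nb)
  obtain S where S: "adj.total_forcing ?W S"
    and alt: "n \<le> \<Delta> * card (?W - S) \<or>
      n = Suc (\<Delta> * card (?W - S)) \<and> (\<exists>k V c. adj.star_partition \<Delta> ?W k V c)"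
    using adj.total_forcing_exists[OF ac conn _ deg] assms(2,3) by blast
  have SW: "S \<subseteq> ?W" using S by (simp add: adj.total_forcing_def adj.forcing_def)
  define f where "f = total_forcing_number T"
  have f_le: "f \<le> card R" if "adj.total_forcing ?W R" for R
    unfolding f_def total_forcing_number_def by (rule Least_le) (use that total_forcing_set_iff in blast)
  have "\<exists>R. total_forcing_set T R \<and> card R = f"
    unfolding f_def total_forcing_number_def
    by (rule LeastI_ex) (use S total_forcing_set_iff in blast)
  then obtain R where R: "adj.total_forcing ?W R" "card R = f"
    using total_forcing_set_iff by blast
  have RW: "R \<subseteq> ?W" using R by (simp add: adj.total_forcing_def adj.forcing_def)
  have cR: "card (?W - R) + f = n" and cS: "card (?W - S) + card S = n"
    using card_Diff_subset[of R ?W] card_Diff_subset[of S ?W] RW SW R(2) assms(2)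
      finite_subset[OF RW] finite_subset[OF SW] card_mono[OF _ RW] card_mono[OF _ SW] by auto
  \<comment> \<open>\<open>R\<close> is a minimum total forcing set, so its complement is
    largest.\<close>
  have "card (?W - S) \<le> card (?W - R)" using f_le[OF S] cR cS by linarith
  then have mono: "\<Delta> * card (?W - S) \<le> \<Delta> * card (?W - R)" by simp
  \<comment> \<open>With all degrees at most 1 there is no pendant star with \<open>u\<close> of
    degree at least 2, so the tree would be a star on at most two vertices.\<close>
  have D2: "2 \<le> \<Delta>"
  proof (rule ccontr)
    assume "\<not> 2 \<le> \<Delta>"
    then have le1: "card (adj.nb ?W x) \<le> 1" if "x \<in> ?W" for x using deg[OF that] by simp
    have "\<exists>c\<in>?W. ?W \<subseteq> insert c (adj.nb ?W c)"
    proof (rule ccontr)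
      assume "\<not> ?thesis"
      moreover have "?W \<noteq> {}" using assms(2,3) by auto
      ultimately obtain u v L where "adj.pendant_star ?W u v L" "2 \<le> card (adj.nb ?W u)"
        using adj.pendant_star_exists[OF ac conn] by blast
      then show False using le1[of u] by (simp add: adj.pendant_star_def)
    qed
    then obtain c where c: "c \<in> ?W" "?W \<subseteq> insert c (adj.nb ?W c)" by blast
    then have "card ?W \<le> Suc (card (adj.nb ?W c))"
      using card_mono[OF _ c(2)] card_insert_le_m1 by (simp add: card_insert_if split: if_splits)
    then show False using le1[OF c(1)] assms(2,3) by simp
  qed
  have fam: "\<Delta> * card (?W - R) < n" if "adj.star_partition \<Delta> ?W k V c" for k V c
  proof -
    note C = adj.star_partition_center_set(1)[OF that]
    have "card (?W - R) \<le> card (c ` {1..k})" using adj.card_Diff_total_forcing_le[OF ac C R(1)] .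
    then have "\<Delta> * card (?W - R) \<le> \<Delta> * card (c ` {1..k})" by (rule mult_le_mono2)
    moreover have "n = Suc (\<Delta> * card (c ` {1..k}))" using C assms(2) by (simp add: adj.center_set_def)
    ultimately show ?thesis by linarith
  qed
  have bound: "n \<le> Suc (\<Delta> * card (?W - R))" using alt mono by linarith
  have "n = Suc (\<Delta> * card (?W - R)) \<longleftrightarrow> (\<exists>k V c. adj.star_partition \<Delta> ?W k V c)"
  proof
    assume "n = Suc (\<Delta> * card (?W - R))"
    then have "\<not> n \<le> \<Delta> * card (?W - S)" using mono by linarith
    then show "\<exists>k V c. adj.star_partition \<Delta> ?W k V c" using alt by blast
  next
    assume "\<exists>k V c. adj.star_partition \<Delta> ?W k V c"
    then have "\<Delta> * card (?W - R) < n" using fam by blast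
    then show "n = Suc (\<Delta> * card (?W - R))" using bound by linarith
  qed
  then have fam_iff: "n = Suc (\<Delta> * card (?W - R)) \<longleftrightarrow> T \<in> tree_family \<Delta>"
    using tree_family_iff[OF assms(1,4) D2] by simp
  \<comment> \<open>The slack of the bound in terms of the complement of \<open>R\<close>; divided
    by \<open>\<Delta>\<close>, it is the slack of the stated bound.\<close>
  let ?d = "1 + real \<Delta> * real (card (?W - R)) - real n"
  have "((real \<Delta> - 1) * real n + 1) / real \<Delta> = real f + ?d / real \<Delta>"
    using D2 by (simp add: field_simps flip: cR)
  moreover have "?d \<ge> 0"
    using bound by (simp flip: of_nat_mult of_nat_Suc)
  moreover have "?d = 0 \<longleftrightarrow> n = Suc (\<Delta> * card (?W - R))"
    by (auto simp flip: of_nat_mult of_nat_Suc)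
  ultimately show ?thesis
    using fam_iff D2 by (simp add: f_def)
qed

end
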